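(* Let $A\in\mathbb{R}^{n\times n}$, $B\in\mathbb{R}^{n\times m}$, let $Q\in\mathbb{R}^{n\times n}$, $R\in\mathbb{R}^{m\times m}$ be symmetric positive definite, $\gamma\in(0,1)$, $x\in\mathbb{R}^n$, and let $K\in\mathbb{R}^{m\times n}$ be such that $A_K:=A+BK$ satisfies $\rho(A_K)<1$. Let $(w_k)_{k\ge 0}$ be i.i.d. random vectors in $\mathbb{R}^n$ with zero mean, positive definite covariance matrix $\Sigma$, and a distribution symmetric about the origin (that is, $w_k$ and $-w_k$ have the same distribution), and let $w$ be a random vector with the same distribution as $w_k$. Let $P$ be the solution of $P=Q+K^\top RK+\gamma A_K^\top PA_K$, and let $G^K(x)$ be the random return defined in the context. Then the exact variance of $G^K(x)$ is $$\operatorname{Var}[G^K(x)]=\frac{\gamma^2}{1-\gamma^2}\,\mathbb{E}\big[(w^\top Pw)^2\big]-\frac{\gamma^2}{1-\gamma^2}\big(\operatorname{tr}(P\Sigma)\big)^2+4\gamma^2\operatorname{tr}(P\Sigma PZ),$$ where $Z\in\mathbb{S}^n_{++}$ is the unique solution of the Lyapunov equation $$Z-\gamma^2A_KZA_K^\top=A_K\Big(xx^\top+\frac{\gamma^2}{1-\gamma^2}\Sigma\Big)A_K^\top .$$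
   Context: $\rho(\cdot)$ denotes the spectral radius and $\mathbb{S}^n_{++}$ the set of real symmetric positive definite $n\times n$ matrices. For the closed-loop system $x_{t+1}=A_Kx_t+v_t$, $x_0=x$, with $v_t$ i.i.d. with the same distribution as $w_k$, the random return is $\sum_{t\ge0}\gamma^t x_t^\top(Q+K^\top RK)x_t$; it is characterized by $$G^K(x)=x^\top Px+2\sum_{k=0}^{\infty}\gamma^{k+1}w_k^\top PA_K^{k+1}x+\sum_{k=0}^{\infty}\gamma^{k+1}w_k^\top Pw_k+2\sum_{k=1}^{\infty}\gamma^{k+1}w_k^\top P\sum_{\tau=0}^{k-1}A_K^{k-\tau}w_\tau ,$$ and $G^K(x)$ denotes this random variable.
   Formalization: The claim that Z is positive definite fails when A_K is singular (A_K = 0 gives Z = 0); proved instead: Z is the unique solution among all real matrices, is symmetric positive semidefinite, and is positive definite if A_K is invertible; the variance formula holds for every stable A_K. *)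

theory Defs
  imports "HOL-Probability.Probability"
begin

text \<open>
  The instance of class \<open>power\<close> for \<open>real ^ 'n ^ 'n\<close> multiplies entrywise, so
  powers with respect to the matrix product need their own constant.
\<close>

primrec matrix_pow :: "real ^ 'n ^ 'n \<Rightarrow> nat \<Rightarrow> real ^ 'n ^ 'n" where
  "matrix_pow A 0 = mat 1"
| "matrix_pow A (Suc k) = A ** matrix_pow A k"

text \<open>
  Eigenvalues are taken over the complex numbers; the set is finite and nonempty, so the
  \<open>Max\<close> below is a genuine maximum.
\<close>

definition complex_eigenvalues :: "real ^ 'n ^ 'n \<Rightarrow> complex set" where
  "complex_eigenvalues A =
     {l. \<exists>v :: complex ^ 'n. v \<noteq> 0 \<and> (\<chi> i j. complex_of_real (A $ i $ j)) *v v = l *s v}"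

definition matrix_spectral_radius :: "real ^ 'n ^ 'n \<Rightarrow> real" where
  "matrix_spectral_radius A = Max (cmod ` complex_eigenvalues A)"

definition sym_matrix :: "real ^ 'n ^ 'n \<Rightarrow> bool" where
  "sym_matrix A \<longleftrightarrow> transpose A = A"

definition sym_pos_def :: "real ^ 'n ^ 'n \<Rightarrow> bool" where
  "sym_pos_def A \<longleftrightarrow> sym_matrix A \<and> (\<forall>x. x \<noteq> 0 \<longrightarrow> x \<bullet> (A *v x) > 0)"

definition sym_pos_semidef :: "real ^ 'n ^ 'n \<Rightarrow> bool" where
  "sym_pos_semidef A \<longleftrightarrow> sym_matrix A \<and> (\<forall>x. x \<bullet> (A *v x) \<ge> 0)"

definition outer_product :: "real ^ 'n \<Rightarrow> real ^ 'n \<Rightarrow> real ^ 'n ^ 'n" where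
  "outer_product x y = (\<chi> i j. x $ i * y $ j)"

text \<open>Meaningful only for square-integrable \<open>X\<close>.\<close>

definition covariance_matrix :: "'a measure \<Rightarrow> ('a \<Rightarrow> real ^ 'n) \<Rightarrow> real ^ 'n ^ 'n" where
  "covariance_matrix M X =
     (\<chi> i j. \<integral>\<omega>. (X \<omega> $ i - (\<integral>\<omega>'. X \<omega>' $ i \<partial>M)) * (X \<omega> $ j - (\<integral>\<omega>'. X \<omega>' $ j \<partial>M)) \<partial>M)"

text \<open>
  The Bochner integral of a non-integrable function is \<open>0\<close>. Expectations of nonnegative
  variables and variances that may be infinite are therefore taken as extended reals.
  The first constant is used only for nonnegative \<open>X\<close>, the second only for integrable \<open>X\<close>.
\<close>

definition ext_expectation :: "'a measure \<Rightarrow> ('a \<Rightarrow> real) \<Rightarrow> ereal" where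
  "ext_expectation M X = enn2ereal (\<integral>\<^sup>+ \<omega>. ennreal (X \<omega>) \<partial>M)"

definition ext_variance :: "'a measure \<Rightarrow> ('a \<Rightarrow> real) \<Rightarrow> ereal" where
  "ext_variance M X = ext_expectation M (\<lambda>\<omega>. (X \<omega> - (\<integral>\<omega>'. X \<omega>' \<partial>M))\<^sup>2)"

text \<open>
  The random return for the closed-loop matrix \<open>F = A + B K\<close>, the matrix \<open>P\<close>, the initial
  state \<open>x\<close> and the noise sequence \<open>w\<close>, as a function of the outcome \<open>\<omega>\<close>. For stable \<open>F\<close>
  and i.i.d. integrable noise all three series converge almost surely. In the last series
  the index may start at \<open>0\<close> instead of \<open>1\<close>, because the inner sum is empty for \<open>k = 0\<close>.
\<close>

definition random_return ::
  "real \<Rightarrow> real ^ 'n ^ 'n \<Rightarrow> real ^ 'n ^ 'n \<Rightarrow> real ^ 'n \<Rightarrow> (nat \<Rightarrow> 'a \<Rightarrow> real ^ 'n) \<Rightarrow> 'a \<Rightarrow> real" where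
  "random_return \<gamma> F P x w \<omega> =
     x \<bullet> (P *v x)
     + 2 * (\<Sum>k. \<gamma> ^ (k + 1) * (w k \<omega> \<bullet> (P *v (matrix_pow F (k + 1) *v x))))
     + (\<Sum>k. \<gamma> ^ (k + 1) * (w k \<omega> \<bullet> (P *v w k \<omega>)))
     + 2 * (\<Sum>k. \<gamma> ^ (k + 1) *
              (w k \<omega> \<bullet> (P *v (\<Sum>\<tau><k. matrix_pow F (k - \<tau>) *v w \<tau> \<omega>))))"

end

(*
  With y_0 = F x and y_(k+1) = F (y_k + w_k), the return is almost surely a constant plus the sum of
  T_k = g^(k+1) (2 w_k . P y_k + w_k . P w_k - tr (P Sigma)), where g is the discount factor.
  Since w_k is independent of y_k and has mean zero, the T_k are martingale differences, so the
  variance is the limit of the sums of E T_k^2. By symmetry of the noise the cross terms of T_k^2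
  vanish, and E (w_k . P y_k)^2 = tr (P Sigma P Y_k) for the second moment matrix Y_k of y_k. The
  recursion Y_(k+1) = F (Y_k + Sigma) F^T makes the sum of the g^(2k) Y_k the solution of the
  Lyapunov equation. If w . P w is not square integrable, then neither is T_0, and the variance is
  infinite because the second moment of a martingale increases.
*)

theory Submission
  imports Defs "Jordan_Normal_Form.Spectral_Radius"
begin

hide_const (open) Matrix.mat
hide_fact (open) Matrix.vec_eq_iff Matrix.mat_def
no_notation vec_index (infixl "$" 100)
no_notation scalar_prod (infix "\<bullet>" 70)

section \<open>Power-bounded matrices and Stein equations\<close>

text \<open>Fourth moments of the noise are not assumed, so E (w . P w)^2 may be infinite and the
  identity has to hold in the extended reals. This gives almost sure convergence to a limit S, the
  mean of the return, and the inequality E S_N^2 <= E S^2 in [0, \<infinity>] for the partial sums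
  S_N; Fatou's lemma gives the opposite direction. Stability is used in the form of bounded powers
  of F. The decay that makes the series converge comes from the weights g^k and g^(2k), against
  which second moments growing linearly in k are harmless. Boundedness of powers is invariant under
  transposition, so it serves the equation for P as well as the one for Z.\<close>

definition power_bounded :: "real ^ 'n ^ 'n \<Rightarrow> bool" where
  "power_bounded F \<longleftrightarrow> (\<exists>c. \<forall>k. norm (matrix_pow F k) \<le> c)"

text \<open>The effect of x -> F x on second moment matrices. The equations for P and Z both have
  the form Z - g F Z F^T = N, a discrete Lyapunov (Stein) equation: with F^T in place of F and g =
  \<gamma> for P, with F and g = \<gamma>^2 for Z.\<close>

definition congruence :: "real ^ 'n ^ 'm \<Rightarrow> real ^ 'n ^ 'n \<Rightarrow> real ^ 'm ^ 'm" where
  "congruence F S = F ** S ** transpose F"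

lemma bounded_bilinear_matrix_matrix_mult:
  "bounded_bilinear ((**) :: real ^ 'n ^ 'm \<Rightarrow> real ^ 'p ^ 'n \<Rightarrow> real ^ 'p ^ 'm)"
  unfolding bilinear_conv_bounded_bilinear[symmetric] bilinear_def
  by (intro conjI allI linearI;
      simp add: vec_eq_iff matrix_matrix_mult_def distrib_left distrib_right sum.distrib sum_distrib_left mult_ac)

lemma bounded_linear_congruence: "bounded_linear (congruence F)"
  using bounded_linear_compose[OF
      bounded_bilinear.bounded_linear_left[OF bounded_bilinear_matrix_matrix_mult, of "transpose F"]
      bounded_bilinear.bounded_linear_right[OF bounded_bilinear_matrix_matrix_mult, of F]]
  unfolding congruence_def .

lemma matrix_pow_commute: "matrix_pow A k ** A = A ** matrix_pow A k"
  by (induction k) (simp_all add: matrix_mul_assoc[symmetric])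

lemma transpose_matrix_pow: "transpose (matrix_pow A k) = matrix_pow (transpose A) k"
  by (induction k) (simp_all add: matrix_transpose_mul matrix_pow_commute)

lemma norm_matrix_eq_sqrt_sum:
  fixes A :: "real ^ 'n ^ 'm"
  shows "norm A = sqrt (\<Sum>i\<in>UNIV. \<Sum>j\<in>UNIV. (A $ i $ j)\<^sup>2)"
  by (simp add: norm_vec_def L2_set_def sum_nonneg)

lemma norm_transpose: "norm (transpose A) = norm (A :: real ^ 'n ^ 'm)"
  unfolding norm_matrix_eq_sqrt_sum transpose_def vec_lambda_beta
  by (subst sum.swap) (rule refl)

lemma power_bounded_transpose: "power_bounded F \<Longrightarrow> power_bounded (transpose F)"
  by (simp add: power_bounded_def norm_transpose flip: transpose_matrix_pow)

lemma congruence_pow: "congruence F (congruence (matrix_pow F k) S) = congruence (matrix_pow F (Suc k)) S"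
  by (simp add: congruence_def matrix_transpose_mul matrix_mul_assoc)

lemma power_bounded_congruenceE:
  fixes F :: "real ^ 'n ^ 'n"
  assumes "power_bounded F"
  obtains c where "\<And>k. norm (congruence (matrix_pow F k) (S :: real ^ 'n ^ 'n)) \<le> c"
proof -
  obtain c where c: "\<And>k. norm (matrix_pow F k) \<le> c"
    using assms unfolding power_bounded_def by blast
  \<comment> \<open>Submultiplicativity up to a constant is enough; \<open>b\<close> is the constant
    of a bounded bilinear map.\<close>
  obtain b where b: "0 \<le> b" "\<And>(A :: real ^ 'n ^ 'n) (B :: real ^ 'n ^ 'n). norm (A ** B) \<le> norm A * norm B * b"
    using bounded_bilinear.nonneg_bounded[OF bounded_bilinear_matrix_matrix_mult] by blast
  have "norm (congruence (matrix_pow F k) S) \<le> (c * norm S * b) * c * b" for k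
  proof -
    have c0: "0 \<le> c" using order_trans[OF norm_ge_zero c] .
    have 1: "norm (matrix_pow F k ** S) \<le> c * norm S * b"
      using b(2)[of "matrix_pow F k" S] mult_right_mono[OF c[of k], of "norm S * b"] b(1)
      by (simp add: mult.assoc)
    have "norm (congruence (matrix_pow F k) S) \<le> norm (matrix_pow F k ** S) * norm (matrix_pow F k) * b"
      using b(2)[of "matrix_pow F k ** S" "transpose (matrix_pow F k)"]
      by (simp add: congruence_def norm_transpose)
    also have "\<dots> \<le> (c * norm S * b) * c * b"
      using 1 c[of k] c0 b(1) by (intro mult_right_mono mult_mono) auto
    finally show ?thesis .
  qed
  then show ?thesis by (rule that)
qed

text \<open>A solution reproduces itself: D = g^k F^k D (F^k)^T for every k, and the right-hand side
  tends to 0 because the powers of F are bounded and g < 1.\<close>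

lemma stein_homogeneous_unique:
  fixes F :: "real ^ 'n ^ 'n"
  assumes "power_bounded F" "0 \<le> g" "g < 1" and D: "D = g *\<^sub>R congruence F D"
  shows "D = 0"
proof -
  obtain c where c: "\<And>k. norm (congruence (matrix_pow F k) D) \<le> c"
    using power_bounded_congruenceE[OF assms(1)] by blast
  have iterate: "D = g ^ k *\<^sub>R congruence (matrix_pow F k) D" for k
  proof (induction k)
    case 0 show ?case by (simp add: congruence_def transpose_mat)
  next
    case (Suc k)
    have "D = g *\<^sub>R congruence F (g ^ k *\<^sub>R congruence (matrix_pow F k) D)"
      using D Suc by simp
    then show ?case
      by (simp only: linear_scale[OF bounded_linear.linear[OF bounded_linear_congruence]] congruence_pow) simp
  qed
  have "norm D \<le> g ^ k * c" for k
    using mult_left_mono[OF c[of k], of "g ^ k"] assms(2) arg_cong[OF iterate[of k], of norm]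
    by simp
  moreover have "(\<lambda>k. g ^ k * c) \<longlonglongrightarrow> 0 * c"
    using assms by (intro tendsto_intros LIMSEQ_realpow_zero) auto
  ultimately have "norm D \<le> 0"
    by (intro LIMSEQ_le_const[of _ 0]) auto
  then show ?thesis by simp
qed

lemma stein_unique:
  fixes F :: "real ^ 'n ^ 'n"
  assumes "power_bounded F" "0 \<le> g" "g < 1"
    and "Z - g *\<^sub>R congruence F Z = N" "Z' - g *\<^sub>R congruence F Z' = N"
  shows "Z = Z'"
proof -
  have "Z = N + g *\<^sub>R congruence F Z" "Z' = N + g *\<^sub>R congruence F Z'"
    using assms(4,5) by (simp_all add: diff_eq_eq)
  then have "Z - Z' = g *\<^sub>R congruence F Z - g *\<^sub>R congruence F Z'"
    by (metis add_diff_cancel_left)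
  then have "Z - Z' = g *\<^sub>R congruence F (Z - Z')"
    unfolding linear_diff[OF bounded_linear.linear[OF bounded_linear_congruence]] scaleR_diff_right .
  then show ?thesis
    using stein_homogeneous_unique[OF assms(1-3)] by fastforce
qed

lemma inner_congruence:
  fixes F :: "real ^ 'n ^ 'm"
  shows "v \<bullet> (congruence F S *v v) = (transpose F *v v) \<bullet> (S *v (transpose F *v v))"
proof -
  have "v \<bullet> (congruence F S *v v) = v \<bullet> (F *v (S *v (transpose F *v v)))"
    by (simp only: congruence_def matrix_vector_mul_assoc matrix_mul_assoc)
  also have "\<dots> = (v v* F) \<bullet> (S *v (transpose F *v v))"
    by (simp only: dot_lmul_matrix)
  finally show ?thesis
    by (simp only: transpose_matrix_vector)
qed

text \<open>Since N contributes a nonnegative term, u . Z u >= g (F^T u) . Z (F^T u). Iterating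
  along u_k = (F^T)^k v leaves the lower bound g^k (u_k . Z u_k), whose second factor stays bounded.
  This works for any solution, with no series representation of Z.\<close>

lemma stein_solution_nonneg:
  fixes F :: "real ^ 'n ^ 'n"
  assumes "power_bounded F" "0 \<le> g" "g < 1"
    and Z: "Z - g *\<^sub>R congruence F Z = N" and N: "\<And>v. 0 \<le> v \<bullet> (N *v v)"
  shows "0 \<le> v \<bullet> (Z *v v)"
proof -
  define F' where "F' = transpose F"
  have step: "u \<bullet> (Z *v u) \<ge> g * ((F' *v u) \<bullet> (Z *v (F' *v u)))" for u
  proof -
    have "u \<bullet> (Z *v u) = u \<bullet> (N *v u) + g * (u \<bullet> (congruence F Z *v u))"
      using arg_cong[OF Z, of "\<lambda>A. u \<bullet> (A *v u)"]
      by (simp add: matrix_vector_mult_diff_rdistrib inner_diff_right scaleR_matrix_vector_assoc[symmetric])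
    then show ?thesis
      using N[of u] by (simp add: inner_congruence F'_def)
  qed
  define u where "u k = matrix_pow F' k *v v" for k
  have iterate: "v \<bullet> (Z *v v) \<ge> g ^ k * (u k \<bullet> (Z *v u k))" for k
  proof (induction k)
    case (Suc k)
    have "g ^ k * (g * (u (Suc k) \<bullet> (Z *v u (Suc k)))) \<le> g ^ k * (u k \<bullet> (Z *v u k))"
      using step[of "u k"] assms(2) by (intro mult_left_mono) (simp_all add: u_def matrix_vector_mul_assoc)
    with Suc show ?case by (simp add: mult_ac)
  qed (simp add: u_def)
  obtain c where c: "\<And>k. norm (congruence (matrix_pow F k) Z) \<le> c"
    using power_bounded_congruenceE[OF assms(1)] by blast
  have quad: "u k \<bullet> (Z *v u k) = v \<bullet> (congruence (matrix_pow F k) Z *v v)" for k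
    by (simp add: u_def F'_def inner_congruence transpose_matrix_pow)
  have "bounded_linear (\<lambda>A :: real ^ 'n ^ 'n. v \<bullet> (A *v v))"
    unfolding linear_conv_bounded_linear[symmetric]
    by (rule linearI) (simp_all add: matrix_vector_mult_add_rdistrib inner_add_right scaleR_matrix_vector_assoc[symmetric])
  then obtain b where b: "0 \<le> b" "\<And>A :: real ^ 'n ^ 'n. norm (v \<bullet> (A *v v)) \<le> norm A * b"
    using bounded_linear.nonneg_bounded by blast
  have "- (c * b) \<le> u k \<bullet> (Z *v u k)" for k
    using order_trans[OF b(2) mult_right_mono[OF c b(1)], of k] unfolding quad by (simp add: abs_le_iff)
  then have "g ^ k * - (c * b) \<le> v \<bullet> (Z *v v)" for k
    using order_trans[OF mult_left_mono iterate] assms(2) by (metis zero_le_power)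
  moreover have "(\<lambda>k. g ^ k * - (c * b)) \<longlonglongrightarrow> 0 * - (c * b)"
    using assms by (intro tendsto_intros LIMSEQ_realpow_zero) auto
  ultimately show ?thesis
    by (intro LIMSEQ_le_const2[of _ 0]) auto
qed

lemma transpose_add: "transpose (A + B) = transpose A + (transpose B :: real ^ 'n ^ 'm)"
  by (simp add: transpose_def vec_eq_iff)

lemma transpose_congruence: "transpose (congruence F S) = congruence F (transpose S)"
  by (simp add: congruence_def matrix_transpose_mul matrix_mul_assoc)

text \<open>Z^T solves the same equation, so uniqueness makes Z symmetric. For definiteness, v . Z v
  is at least (F^T v) . S (F^T v), which is positive for v \<noteq> 0 once F^T is injective. If F^T
  v = 0, the equation forces v . Z v = 0, hence the invertibility condition.\<close>

lemma
  fixes F S :: "real ^ 'n ^ 'n"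
  assumes F: "power_bounded F" and g: "0 \<le> g" "g < 1" and S: "sym_matrix S" "\<And>v. 0 \<le> v \<bullet> (S *v v)"
    and Z: "Z - g *\<^sub>R congruence F Z = congruence F S"
  shows stein_solution_sym_pos_semidef: "sym_pos_semidef Z"
    and stein_solution_sym_pos_def: "invertible F \<Longrightarrow> sym_pos_def S \<Longrightarrow> sym_pos_def Z"
proof -
  have "Z = congruence F S + g *\<^sub>R congruence F Z"
    using Z by (simp add: diff_eq_eq)
  then have "transpose Z = congruence F S + g *\<^sub>R congruence F (transpose Z)"
    using S(1) unfolding sym_matrix_def by (metis transpose_add transpose_congruence transpose_scalar)
  then have "transpose Z - g *\<^sub>R congruence F (transpose Z) = congruence F S"
    by (simp only: diff_eq_eq)
  from stein_unique[OF F g this Z] have sym: "sym_matrix Z"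
    by (simp add: sym_matrix_def)
  have nonneg: "0 \<le> v \<bullet> (Z *v v)" for v
    by (rule stein_solution_nonneg[OF F g Z]) (simp only: inner_congruence S(2))
  show "sym_pos_semidef Z"
    using sym nonneg by (simp add: sym_pos_semidef_def)
  assume inv: "invertible F" and pos: "sym_pos_def S"
  have "0 < v \<bullet> (Z *v v)" if "v \<noteq> 0" for v
  proof -
    have "transpose F *v v \<noteq> 0"
    proof
      assume "transpose F *v v = 0"
      moreover have "inj ((*v) (transpose F))"
        using inv transpose_invertible invertible_left_inverse matrix_left_invertible_injective by blast
      ultimately show False
        using \<open>v \<noteq> 0\<close> by (metis injD matrix_vector_mult_0_right)
    qed
    then have "0 < v \<bullet> (congruence F S *v v)"
      using pos unfolding inner_congruence sym_pos_def_def by blast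
    moreover have "v \<bullet> (Z *v v) = v \<bullet> (congruence F S *v v) + g * (v \<bullet> (congruence F Z *v v))"
      using arg_cong[OF Z, of "\<lambda>A. v \<bullet> (A *v v)"]
      by (simp add: matrix_vector_mult_diff_rdistrib inner_diff_right scaleR_matrix_vector_assoc[symmetric])
    moreover have "0 \<le> g * (v \<bullet> (congruence F Z *v v))"
      unfolding inner_congruence using g nonneg by (intro mult_nonneg_nonneg) auto
    ultimately show ?thesis by linarith
  qed
  with sym show "sym_pos_def Z"
    by (simp add: sym_pos_def_def)
qed

section \<open>Rank-one initial moments and discounted sums of second moments\<close>

lemma inner_outer_product: "v \<bullet> (outer_product x x *v v) = (x \<bullet> v)\<^sup>2"
  by (simp add: outer_product_def matrix_vector_mult_def inner_vec_def power2_eq_square sum_product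
      sum_distrib_left mult_ac)

text \<open>With S0 = x x^T and S the noise covariance this will be E (y_k y_k^T). It starts at F S0
  F^T because y_0 = F x has already been propagated once.\<close>

primrec second_moment_seq :: "real ^ 'n ^ 'n \<Rightarrow> real ^ 'n ^ 'n \<Rightarrow> real ^ 'n ^ 'n \<Rightarrow> nat \<Rightarrow> real ^ 'n ^ 'n" where
  "second_moment_seq F S0 S 0 = congruence F S0"
| "second_moment_seq F S0 S (Suc k) = congruence F (second_moment_seq F S0 S k + S)"

lemma second_moment_seq_eq:
  "second_moment_seq F S0 S k = congruence (matrix_pow F (Suc k)) S0 + (\<Sum>j<k. congruence (matrix_pow F (Suc j)) S)"
proof (induction k)
  case (Suc k)
  show ?case
    by (simp only: second_moment_seq.simps Suc linear_add[OF bounded_linear.linear[OF bounded_linear_congruence]]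
      linear_sum[OF bounded_linear.linear[OF bounded_linear_congruence]] congruence_pow sum.lessThan_Suc_shift)
      (simp add: add_ac)
qed simp

text \<open>The unrolled recursion is a sum of k + 1 uniformly bounded matrices, so the norms grow
  at most linearly in k and the weight g^k dominates.\<close>

lemma summable_second_moment_seq:
  fixes F :: "real ^ 'n ^ 'n"
  assumes "power_bounded F" "0 \<le> g" "g < 1"
  shows "summable (\<lambda>k. g ^ k *\<^sub>R second_moment_seq F S0 S k)"
proof -
  obtain c where c: "\<And>k. norm (congruence (matrix_pow F k) S0) \<le> c"
    using power_bounded_congruenceE[OF assms(1)] by blast
  obtain d where d: "\<And>k. norm (congruence (matrix_pow F k) S) \<le> d"
    using power_bounded_congruenceE[OF assms(1)] by blast
  have bound: "norm (second_moment_seq F S0 S k) \<le> c + real k * d" for k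
    unfolding second_moment_seq_eq
  proof (intro norm_triangle_le add_mono)
    show "norm (\<Sum>j<k. congruence (matrix_pow F (Suc j)) S) \<le> real k * d"
      using sum_norm_le[of "{..<k}" "\<lambda>j. congruence (matrix_pow F (Suc j)) S" "\<lambda>_. d"] d[of "Suc _"]
      by simp
  qed (rule c)
  have "norm g < 1" using assms by simp
  \<comment> \<open>Differentiating the geometric series gives the sum of (k + 1) g^k, so k g^k is
    written as (k + 1) g^k - g^k.\<close>
  then have "summable (\<lambda>k. c * g ^ k + d * (real (Suc k) * g ^ k - g ^ k))"
    by (intro summable_add summable_mult summable_diff summable_geometric
        sums_summable[OF geometric_deriv_sums[of g]])
  then have "summable (\<lambda>k. g ^ k * (c + real k * d))"
    by (simp add: algebra_simps)
  then show ?thesis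
    by (rule summable_comparison_test') (use bound assms in \<open>auto intro!: mult_left_mono\<close>)
qed

text \<open>Multiplying the recursion by g^(k+1) and summing over k gives Z - Y_0 = g F (Z + S / (1
  - g)) F^T; the geometric series of the constant S is the origin of the factor g / (1 - g).\<close>

lemma suminf_second_moment_seq:
  fixes F S0 S :: "real ^ 'n ^ 'n"
  assumes "power_bounded F" "0 \<le> g" "g < 1"
  defines "Z \<equiv> \<Sum>k. g ^ k *\<^sub>R second_moment_seq F S0 S k"
  shows "Z - g *\<^sub>R congruence F Z = congruence F (S0 + (g / (1 - g)) *\<^sub>R S)"
proof -
  note lin = bounded_linear.linear[OF bounded_linear_congruence[of F]]
  note sm = summable_second_moment_seq[OF assms(1-3), of S0 S]
  have geo: "(\<lambda>k. g ^ k *\<^sub>R S) sums ((1 / (1 - g)) *\<^sub>R S)"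
    using assms by (intro bounded_linear.sums[OF bounded_linear_scaleR_left] geometric_sums) auto
  have "(\<lambda>k. g *\<^sub>R congruence F (g ^ k *\<^sub>R second_moment_seq F S0 S k + g ^ k *\<^sub>R S)) sums
      (g *\<^sub>R congruence F (Z + (1 / (1 - g)) *\<^sub>R S))"
    unfolding Z_def
    by (intro sums_scaleR_right bounded_linear.sums[OF bounded_linear_congruence] sums_add geo summable_sums sm)
  then have "(\<lambda>k. g ^ Suc k *\<^sub>R second_moment_seq F S0 S (Suc k)) sums
      (g *\<^sub>R congruence F (Z + (1 / (1 - g)) *\<^sub>R S))"
    by (simp add: linear_scale[OF lin] scaleR_add_right[symmetric] del: scaleR_add_right)
  from sums_unique[OF this] suminf_split_head[OF sm]
  have "Z - congruence F S0 = g *\<^sub>R congruence F (Z + (1 / (1 - g)) *\<^sub>R S)"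
    unfolding Z_def by simp
  then show ?thesis
    by (simp add: linear_add[OF lin] linear_scale[OF lin] algebra_simps)
qed

section \<open>Spectral radius and power-boundedness\<close>

text \<open>Spectral radius theory is formulated for matrices with a carrier, indexed by numbers;
  \<open>J\<close> is \<open>F\<close> in that format. \<open>V\<close> is the corresponding linear
  bijection of vectors. It intertwines the two matrix actions and so carries eigenvectors to
  eigenvectors.\<close>

lemma complex_eigenvalues_correspondence:
  fixes F :: "real ^ 'n ^ 'n" and f :: "nat \<Rightarrow> 'n"
  assumes f: "bij_betw f {0..<CARD('n)} UNIV"
  defines "J \<equiv> Matrix.mat CARD('n) CARD('n) (\<lambda>(i, j). complex_of_real (F $ f i $ f j))"
  shows "spectrum J = complex_eigenvalues F"
proof -
  let ?n = "CARD('n)"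
  define V where "V = (\<lambda>u :: complex ^ 'n. Matrix.vec ?n (\<lambda>i. u $ f i))"
  have inj: "inj V"
  proof (rule injI)
    fix u v assume eq: "V u = V v"
    have "u $ i = v $ i" for i
    proof -
      obtain k where "k < ?n" "i = f k"
        using f unfolding bij_betw_def by (metis UNIV_I atLeastLessThan_iff imageE)
      then show ?thesis
        using arg_cong[OF eq, of "\<lambda>x. vec_index x k"] by (simp add: V_def)
    qed
    then show "u = v" by (simp add: Finite_Cartesian_Product.vec_eq_iff)
  qed
  have surj: "\<exists>u. v = V u" if "v \<in> carrier_vec ?n" for v
  proof
    show "v = V (\<chi> i. vec_index v (inv_into {0..<?n} f i))"
      using that f by (intro eq_vecI) (auto simp: V_def bij_betw_inv_into_left)
  qed
  have zero: "V 0 = 0\<^sub>v ?n" by (auto simp: V_def)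
  have smult: "V (l *s u) = l \<cdot>\<^sub>v V u" for l u by (auto simp: V_def)
  have mult: "V ((\<chi> i j. complex_of_real (F $ i $ j)) *v u) = J *\<^sub>v V u" for u
    by (rule eq_vecI) (auto simp: V_def J_def scalar_prod_def matrix_vector_mult_def
        sum.reindex_bij_betw[OF f, of "\<lambda>k. complex_of_real (F $ f _ $ k) * u $ k", symmetric])
  have dim: "dim_row J = ?n" and V_carrier: "V u \<in> carrier_vec ?n" for u
    by (auto simp: J_def V_def)
  have "eigenvalue J l \<longleftrightarrow> (\<exists>u. V u \<noteq> V 0 \<and> J *\<^sub>v V u = l \<cdot>\<^sub>v V u)" for l
    unfolding eigenvalue_def eigenvector_def dim zero
    using surj V_carrier by metis
  also have "\<dots> l \<longleftrightarrow> l \<in> complex_eigenvalues F" for l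
    unfolding complex_eigenvalues_def mult[symmetric] smult[symmetric] inj_eq[OF inj] by simp
  finally show ?thesis unfolding spectrum_def by auto
qed

text \<open>\<open>J\<close> is multiplicative and unital, hence sends powers to powers. For a
  complex matrix of spectral radius below 1 the entries of all powers have a common bound, since
  every Jordan block has an eigenvalue of modulus less than 1.\<close>

lemma matrix_pow_entries_bounded:
  fixes F :: "real ^ 'n ^ 'n"
  assumes "matrix_spectral_radius F < 1"
  obtains c where "\<And>k i j. \<bar>matrix_pow F k $ i $ j\<bar> \<le> c"
proof -
  let ?n = "CARD('n)"
  obtain f :: "nat \<Rightarrow> 'n" where f: "bij_betw f {0..<?n} UNIV"
    using ex_bij_betw_nat_finite[OF finite] by blast
  define J where "J = (\<lambda>A :: real ^ 'n ^ 'n.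
    Matrix.mat ?n ?n (\<lambda>(i, j). complex_of_real (A $ f i $ f j)))"
  have J: "J A \<in> carrier_mat ?n ?n" for A by (simp add: J_def)
  have mult: "J (A ** B) = J A * J B" for A B
    by (rule eq_matI) (auto simp: J_def scalar_prod_def matrix_matrix_mult_def
        sum.reindex_bij_betw[OF f, of "\<lambda>k. complex_of_real (A $ f _ $ k) * complex_of_real (B $ k $ f _)", symmetric])
  have one: "J (mat 1) = 1\<^sub>m ?n"
    using f by (intro eq_matI) (auto simp: J_def Finite_Cartesian_Product.mat_def bij_betw_def inj_on_eq_iff)
  have pow: "J (matrix_pow F k) = J F ^\<^sub>m k" for k
  proof (induction k)
    case (Suc k)
    \<comment> \<open>\<open>^\<^sub>m\<close> appends the new factor on the right,
      \<open>matrix_pow\<close> on the left.\<close>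
    have "matrix_pow F (Suc k) = matrix_pow F k ** F"
      by (simp add: matrix_pow_commute)
    with Suc show ?case by (simp only: mult pow_mat.simps)
  qed (simp add: one carrier_matD[OF J])
  have "spectral_radius (J F) < 1"
    using assms complex_eigenvalues_correspondence[OF f, of F]
    by (simp add: matrix_spectral_radius_def spectral_radius_def J_def)
  then obtain c where c: "norm_bound (J F ^\<^sub>m k) c" for k
    using spectral_radius_jnf_norm_bound_less_1_upper_triangular[OF J] by blast
  have "\<bar>matrix_pow F k $ i $ j\<bar> \<le> c" for k i j
  proof -
    obtain a b where "a < ?n" "i = f a" "b < ?n" "j = f b"
      using f unfolding bij_betw_def by (metis UNIV_I atLeastLessThan_iff imageE)
    then show ?thesis
      using c[of k] unfolding pow[symmetric] norm_bound_def by (auto simp: J_def)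
  qed
  then show ?thesis by (rule that)
qed

lemma power_boundedI_entries:
  fixes F :: "real ^ 'n ^ 'n"
  assumes "\<And>k i j. \<bar>matrix_pow F k $ i $ j\<bar> \<le> c"
  shows "power_bounded F"
  unfolding power_bounded_def
proof (intro exI allI)
  fix k
  show "norm (matrix_pow F k) \<le> sqrt (\<Sum>i\<in>(UNIV :: 'n set). \<Sum>j\<in>(UNIV :: 'n set). c\<^sup>2)"
    unfolding norm_matrix_eq_sqrt_sum
    using power_mono[OF assms abs_ge_zero, of k _ _ 2] by (intro real_sqrt_le_mono sum_mono) simp
qed

lemma power_bounded_if_spectral_radius_less_1:
  "matrix_spectral_radius F < 1 \<Longrightarrow> power_bounded F"
  by (metis matrix_pow_entries_bounded power_boundedI_entries)

section \<open>Series of martingale differences\<close>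

text \<open>By Tonelli the expected sum of the norms is the sum of the expectations, which is
  finite; so the sum of the norms is finite almost everywhere.\<close>

lemma AE_summable_norm:
  fixes f :: "nat \<Rightarrow> 'a \<Rightarrow> 'b :: {banach, second_countable_topology}"
  assumes f: "\<And>k. integrable M (f k)" and sum: "summable (\<lambda>k. \<integral>x. norm (f k x) \<partial>M)"
  shows "AE x in M. summable (\<lambda>k. norm (f k x))"
proof -
  have [measurable]: "f k \<in> borel_measurable M" for k using f by auto
  have "(\<integral>\<^sup>+ x. (\<Sum>k. ennreal (norm (f k x))) \<partial>M) = (\<Sum>k. \<integral>\<^sup>+ x. ennreal (norm (f k x)) \<partial>M)"
    by (intro nn_integral_suminf) auto
  also have "\<dots> = (\<Sum>k. ennreal (\<integral>x. norm (f k x) \<partial>M))"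
    using f by (intro arg_cong[of _ _ suminf] ext nn_integral_eq_integral) auto
  also have "\<dots> \<noteq> \<infinity>"
    unfolding infinity_ennreal_def by (rule ennreal_suminf_neq_top[OF sum]) simp
  finally have "AE x in M. (\<Sum>k. ennreal (norm (f k x))) \<noteq> \<infinity>"
    by (intro nn_integral_PInf_AE) auto
  then show ?thesis
    by eventually_elim (auto intro: summable_suminf_not_top)
qed

lemma integrable_mult_of_squares:
  fixes f g :: "'a \<Rightarrow> real"
  assumes [measurable]: "f \<in> borel_measurable M" "g \<in> borel_measurable M"
    and "integrable M (\<lambda>x. (f x)\<^sup>2)" "integrable M (\<lambda>x. (g x)\<^sup>2)"
  shows "integrable M (\<lambda>x. f x * g x)"
proof (rule Bochner_Integration.integrable_bound)
  show "integrable M (\<lambda>x. (f x)\<^sup>2 + (g x)\<^sup>2)" using assms by simp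
  have "\<bar>a * b\<bar> \<le> a\<^sup>2 + b\<^sup>2" for a b :: real
    using sum_squares_bound[of "\<bar>a\<bar>" "\<bar>b\<bar>"] mult_nonneg_nonneg[of "\<bar>a\<bar>" "\<bar>b\<bar>"]
    unfolding abs_mult power2_abs by linarith
  then show "AE x in M. norm (f x * g x) \<le> norm ((f x)\<^sup>2 + (g x)\<^sup>2)" by simp
qed simp

text \<open>
  The lower bound tests the limit against truncations of the partial sum, which uses orthogonality
  to bounded functions only; so no square integrability is needed and the value may be infinite.
\<close>

lemma (in prob_space)
  fixes T :: "nat \<Rightarrow> 'a \<Rightarrow> real"
  assumes T: "\<And>k. integrable M (T k)"
    and sum: "summable (\<lambda>k. expectation (\<lambda>\<omega>. \<bar>T k \<omega>\<bar>))"
    and orth: "\<And>N k \<phi> b. N \<le> k \<Longrightarrow> \<phi> \<in> borel_measurable borel \<Longrightarrow> (\<And>t. \<bar>\<phi> t\<bar> \<le> b) \<Longrightarrow>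
      expectation (\<lambda>\<omega>. T k \<omega> * \<phi> (\<Sum>j<N. T j \<omega>)) = 0"
  shows nn_integral_square_partial_sum_le:
      "(\<integral>\<^sup>+ \<omega>. ennreal ((\<Sum>k<N. T k \<omega>)\<^sup>2) \<partial>M) \<le> (\<integral>\<^sup>+ \<omega>. ennreal ((\<Sum>k. T k \<omega>)\<^sup>2) \<partial>M)"
    and nn_integral_square_partial_sum_LIMSEQ:
      "(\<lambda>N. \<integral>\<^sup>+ \<omega>. ennreal ((\<Sum>k<N. T k \<omega>)\<^sup>2) \<partial>M) \<longlonglongrightarrow> (\<integral>\<^sup>+ \<omega>. ennreal ((\<Sum>k. T k \<omega>)\<^sup>2) \<partial>M)"
proof -
  define S where "S N \<omega> = (\<Sum>k<N. T k \<omega>)" for N \<omega>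
  define H where "H \<omega> = (\<Sum>k. T k \<omega>)" for \<omega>
  have [measurable]: "T k \<in> borel_measurable M" for k using T by auto
  have [measurable]: "S N \<in> borel_measurable M" "H \<in> borel_measurable M" for N
    unfolding S_def H_def by measurable
  have summ: "AE \<omega> in M. summable (\<lambda>k. \<bar>T k \<omega>\<bar>)"
    using AE_summable_norm[of M T] T sum by simp
  have le: "(\<integral>\<^sup>+ \<omega>. ennreal ((S N \<omega>)\<^sup>2) \<partial>M) \<le> (\<integral>\<^sup>+ \<omega>. ennreal ((H \<omega>)\<^sup>2) \<partial>M)" for N
  proof (cases "(\<integral>\<^sup>+ \<omega>. ennreal ((H \<omega>)\<^sup>2) \<partial>M) = \<infinity>")
    case False
    then have H2: "integrable M (\<lambda>\<omega>. (H \<omega>)\<^sup>2)"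
      by (intro integrableI_nonneg) (auto simp: top.not_eq_extremum)
    \<comment> \<open>Values beyond n are sent to 0, not clamped to n: then t times
      \<open>\<phi> n t\<close> is exactly the square of \<open>\<phi> n t\<close>, which gives E
      (S_N h) = E h^2 below.\<close>
    define \<phi> where "\<phi> n t = (if \<bar>t\<bar> \<le> real n then t else 0)" for n t
    have [measurable]: "\<phi> n \<in> borel_measurable borel" for n
      unfolding \<phi>_def by measurable
    have \<phi>_le: "\<bar>\<phi> n t\<bar> \<le> real n" for n t by (simp add: \<phi>_def)
    have trunc: "(\<integral>\<^sup>+ \<omega>. ennreal ((\<phi> n (S N \<omega>))\<^sup>2) \<partial>M) \<le> (\<integral>\<^sup>+ \<omega>. ennreal ((H \<omega>)\<^sup>2) \<partial>M)" for n
    proof -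
      define h where "h \<omega> = \<phi> n (S N \<omega>)" for \<omega>
      have [measurable]: "h \<in> borel_measurable M" unfolding h_def by measurable
      have h_le: "\<bar>h \<omega>\<bar> \<le> real n" for \<omega> by (simp add: h_def \<phi>_le)
      have Th_le: "\<bar>T k \<omega> * h \<omega>\<bar> \<le> real n * \<bar>T k \<omega>\<bar>" for k \<omega>
        using mult_left_mono[OF h_le, of "\<bar>T k \<omega>\<bar>" \<omega>] by (simp add: abs_mult mult.commute)
      have Th: "integrable M (\<lambda>\<omega>. T k \<omega> * h \<omega>)" for k
        by (rule Bochner_Integration.integrable_bound[OF integrable_mult_right[of "real n", OF T[of k]]])
          (use Th_le in \<open>auto simp: abs_mult\<close>)
      have h2: "integrable M (\<lambda>\<omega>. (h \<omega>)\<^sup>2)"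
        by (rule integrable_const_bound[of _ "(real n)\<^sup>2"]) (auto intro!: power2_mono h_le simp: abs_le_square_iff[symmetric])
      have "expectation (\<lambda>\<omega>. \<bar>T k \<omega> * h \<omega>\<bar>) \<le> expectation (\<lambda>\<omega>. real n * \<bar>T k \<omega>\<bar>)" for k
        using T[of k] Th[of k] Th_le by (intro integral_mono) auto
      then have "expectation (\<lambda>\<omega>. \<bar>T k \<omega> * h \<omega>\<bar>) \<le> real n * expectation (\<lambda>\<omega>. \<bar>T k \<omega>\<bar>)" for k
        by simp
      then have sumTh: "summable (\<lambda>k. expectation (\<lambda>\<omega>. \<bar>T k \<omega> * h \<omega>\<bar>))"
        by (intro summable_comparison_test'[OF summable_mult[OF sum, of "real n"], of 0]) auto
      have "(\<lambda>k. expectation (\<lambda>\<omega>. T k \<omega> * h \<omega>)) sums expectation (\<lambda>\<omega>. \<Sum>k. T k \<omega> * h \<omega>)"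
        using Th sumTh AE_summable_norm[of M "\<lambda>k \<omega>. T k \<omega> * h \<omega>"] by (intro sums_integral) auto
      \<comment> \<open>\<open>h\<close> is a bounded function of the first N terms, so
        orthogonality annihilates every term of index at least N.\<close>
      moreover have "(\<lambda>k. expectation (\<lambda>\<omega>. T k \<omega> * h \<omega>)) sums (\<Sum>k<N. expectation (\<lambda>\<omega>. T k \<omega> * h \<omega>))"
        using orth[of N _ "\<phi> n" "real n"] \<phi>_le by (intro sums_finite) (auto simp: h_def S_def)
      ultimately have "expectation (\<lambda>\<omega>. \<Sum>k. T k \<omega> * h \<omega>) = (\<Sum>k<N. expectation (\<lambda>\<omega>. T k \<omega> * h \<omega>))"
        by (rule sums_unique2)
      also have "\<dots> = expectation (\<lambda>\<omega>. S N \<omega> * h \<omega>)"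
        unfolding S_def sum_distrib_right using Th by (intro Bochner_Integration.integral_sum[symmetric]) auto
      also have "\<dots> = expectation (\<lambda>\<omega>. (h \<omega>)\<^sup>2)"
        by (intro Bochner_Integration.integral_cong) (auto simp: h_def \<phi>_def power2_eq_square)
      finally have eq: "expectation (\<lambda>\<omega>. (h \<omega>)\<^sup>2) = expectation (\<lambda>\<omega>. \<Sum>k. T k \<omega> * h \<omega>)" ..
      have "AE \<omega> in M. (\<Sum>k. T k \<omega> * h \<omega>) = H \<omega> * h \<omega>"
        using summ unfolding H_def by eventually_elim (metis suminf_mult2 summable_rabs_cancel)
      then have "expectation (\<lambda>\<omega>. \<Sum>k. T k \<omega> * h \<omega>) = expectation (\<lambda>\<omega>. H \<omega> * h \<omega>)"
        by (intro integral_cong_AE) auto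
      also have "\<dots> \<le> expectation (\<lambda>\<omega>. ((H \<omega>)\<^sup>2 + (h \<omega>)\<^sup>2) / 2)"
      proof (rule integral_mono)
        show "H \<omega> * h \<omega> \<le> ((H \<omega>)\<^sup>2 + (h \<omega>)\<^sup>2) / 2" for \<omega>
          using sum_squares_bound[of "H \<omega>" "h \<omega>"] by simp
      qed (use H2 h2 in \<open>auto intro!: integrable_mult_of_squares\<close>)
      also have "\<dots> = (expectation (\<lambda>\<omega>. (H \<omega>)\<^sup>2) + expectation (\<lambda>\<omega>. (h \<omega>)\<^sup>2)) / 2"
        using H2 h2 by simp
      finally have ineq: "expectation (\<lambda>\<omega>. \<Sum>k. T k \<omega> * h \<omega>)
          \<le> (expectation (\<lambda>\<omega>. (H \<omega>)\<^sup>2) + expectation (\<lambda>\<omega>. (h \<omega>)\<^sup>2)) / 2" .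
      \<comment> \<open>E h^2 can be absorbed into the left-hand side because h is bounded, so that
        this expectation is finite.\<close>
      have half: "a \<le> b" if "a \<le> (b + a) / 2" for a b :: real
        using that by simp
      have "expectation (\<lambda>\<omega>. (h \<omega>)\<^sup>2) \<le> expectation (\<lambda>\<omega>. (H \<omega>)\<^sup>2)"
        by (rule half) (use ineq eq in simp)
      then show ?thesis
        using H2 h2 by (simp add: nn_integral_eq_integral h_def[symmetric])
    qed
    have lim: "(\<lambda>n. ennreal ((\<phi> n t)\<^sup>2)) \<longlonglongrightarrow> ennreal (t\<^sup>2)" for t
    proof -
      obtain m where "\<bar>t\<bar> \<le> real m" using real_arch_simple by blast
      then have "\<phi> n t = t" if "n \<ge> m" for n
        using that by (simp add: \<phi>_def)
      then show ?thesis
        by (intro tendsto_eventually) (metis (mono_tags, lifting) eventually_sequentially)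
    qed
    \<comment> \<open>Fatou's lemma in the truncation level removes the truncation.\<close>
    have "(\<integral>\<^sup>+ \<omega>. ennreal ((S N \<omega>)\<^sup>2) \<partial>M) = (\<integral>\<^sup>+ \<omega>. liminf (\<lambda>n. ennreal ((\<phi> n (S N \<omega>))\<^sup>2)) \<partial>M)"
      by (intro nn_integral_cong lim_imp_Liminf[symmetric] lim trivial_limit_sequentially)
    also have "\<dots> \<le> liminf (\<lambda>n. \<integral>\<^sup>+ \<omega>. ennreal ((\<phi> n (S N \<omega>))\<^sup>2) \<partial>M)"
      by (intro nn_integral_liminf) auto
    also have "\<dots> \<le> (\<integral>\<^sup>+ \<omega>. ennreal ((H \<omega>)\<^sup>2) \<partial>M)"
      using Liminf_mono[of "\<lambda>n. \<integral>\<^sup>+ \<omega>. ennreal ((\<phi> n (S N \<omega>))\<^sup>2) \<partial>M" "\<lambda>_. \<integral>\<^sup>+ \<omega>. ennreal ((H \<omega>)\<^sup>2) \<partial>M" sequentially]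
        trunc by (simp add: Liminf_const)
    finally show ?thesis .
  qed simp
  \<comment> \<open>The partial sums converge almost surely, so Fatou's lemma in N bounds E H^2 by
    the lower limit of E S_N^2. Together with \<open>le\<close> this is convergence in
    [0, \<infinity>].\<close>
  have "(\<integral>\<^sup>+ \<omega>. ennreal ((H \<omega>)\<^sup>2) \<partial>M) = (\<integral>\<^sup>+ \<omega>. liminf (\<lambda>N. ennreal ((S N \<omega>)\<^sup>2)) \<partial>M)"
  proof (rule nn_integral_cong_AE)
    show "AE \<omega> in M. ennreal ((H \<omega>)\<^sup>2) = liminf (\<lambda>N. ennreal ((S N \<omega>)\<^sup>2))"
      using summ
    proof eventually_elim
      fix \<omega> assume "summable (\<lambda>k. \<bar>T k \<omega>\<bar>)"
      then have "(\<lambda>N. S N \<omega>) \<longlonglongrightarrow> H \<omega>"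
        unfolding S_def H_def by (rule summable_LIMSEQ[OF summable_rabs_cancel])
      then show "ennreal ((H \<omega>)\<^sup>2) = liminf (\<lambda>N. ennreal ((S N \<omega>)\<^sup>2))"
        by (intro lim_imp_Liminf[symmetric] tendsto_ennrealI tendsto_power trivial_limit_sequentially)
    qed
  qed
  also have "\<dots> \<le> liminf (\<lambda>N. \<integral>\<^sup>+ \<omega>. ennreal ((S N \<omega>)\<^sup>2) \<partial>M)"
    by (intro nn_integral_liminf) auto
  finally have fatou: "(\<integral>\<^sup>+ \<omega>. ennreal ((H \<omega>)\<^sup>2) \<partial>M) \<le> liminf (\<lambda>N. \<integral>\<^sup>+ \<omega>. ennreal ((S N \<omega>)\<^sup>2) \<partial>M)" .
  have "(\<lambda>N. \<integral>\<^sup>+ \<omega>. ennreal ((S N \<omega>)\<^sup>2) \<partial>M) \<longlonglongrightarrow> (\<integral>\<^sup>+ \<omega>. ennreal ((H \<omega>)\<^sup>2) \<partial>M)"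
  proof (rule order_tendstoI)
    fix l assume "l < (\<integral>\<^sup>+ \<omega>. ennreal ((H \<omega>)\<^sup>2) \<partial>M)"
    then show "\<forall>\<^sub>F N in sequentially. l < (\<integral>\<^sup>+ \<omega>. ennreal ((S N \<omega>)\<^sup>2) \<partial>M)"
      using fatou by (intro less_LiminfD) auto
  next
    fix u assume "(\<integral>\<^sup>+ \<omega>. ennreal ((H \<omega>)\<^sup>2) \<partial>M) < u"
    then show "\<forall>\<^sub>F N in sequentially. (\<integral>\<^sup>+ \<omega>. ennreal ((S N \<omega>)\<^sup>2) \<partial>M) < u"
      using le by (intro always_eventually) (auto intro: le_less_trans)
  qed
  with le show "(\<integral>\<^sup>+ \<omega>. ennreal ((\<Sum>k<N. T k \<omega>)\<^sup>2) \<partial>M) \<le> (\<integral>\<^sup>+ \<omega>. ennreal ((\<Sum>k. T k \<omega>)\<^sup>2) \<partial>M)"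
    and "(\<lambda>N. \<integral>\<^sup>+ \<omega>. ennreal ((\<Sum>k<N. T k \<omega>)\<^sup>2) \<partial>M) \<longlonglongrightarrow> (\<integral>\<^sup>+ \<omega>. ennreal ((\<Sum>k. T k \<omega>)\<^sup>2) \<partial>M)"
    unfolding S_def H_def by blast+
qed

text \<open>Subfamilies over the disjoint index sets {k} and {..<k} are independent. A function of
  the past is a measurable function on the product space over {..<k}, hence the restricted sequence
  as argument.\<close>

lemma (in prob_space)
  fixes w :: "nat \<Rightarrow> 'a \<Rightarrow> 'b :: topological_space" and f :: "'b \<Rightarrow> real" and g :: "(nat \<Rightarrow> 'b) \<Rightarrow> real"
  assumes indep: "indep_vars (\<lambda>_. borel) w UNIV"
    and f: "f \<in> borel_measurable borel" "integrable M (\<lambda>\<omega>. f (w k \<omega>))"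
    and g: "g \<in> borel_measurable (PiM {..<k} (\<lambda>_. borel))"
      "integrable M (\<lambda>\<omega>. g (restrict (\<lambda>i. w i \<omega>) {..<k}))"
  shows integrable_mult_indep_past:
      "integrable M (\<lambda>\<omega>. f (w k \<omega>) * g (restrict (\<lambda>i. w i \<omega>) {..<k}))"
    and expectation_mult_indep_past:
      "expectation (\<lambda>\<omega>. f (w k \<omega>) * g (restrict (\<lambda>i. w i \<omega>) {..<k})) =
        expectation (\<lambda>\<omega>. f (w k \<omega>)) * expectation (\<lambda>\<omega>. g (restrict (\<lambda>i. w i \<omega>) {..<k}))"
proof -
  have "indep_var borel ((\<lambda>v. f (v k)) \<circ> (\<lambda>\<omega>. restrict (\<lambda>i. w i \<omega>) {k}))
      borel (g \<circ> (\<lambda>\<omega>. restrict (\<lambda>i. w i \<omega>) {..<k}))"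
    by (intro indep_var_compose[OF indep_var_restrict[OF indep]] g
        measurable_compose[OF measurable_component_singleton[of k "{k}" "\<lambda>_. borel"] f(1)]) auto
  then have "indep_var borel (\<lambda>\<omega>. f (w k \<omega>)) borel (\<lambda>\<omega>. g (restrict (\<lambda>i. w i \<omega>) {..<k}))"
    by (simp add: comp_def)
  then show "integrable M (\<lambda>\<omega>. f (w k \<omega>) * g (restrict (\<lambda>i. w i \<omega>) {..<k}))"
    and "expectation (\<lambda>\<omega>. f (w k \<omega>) * g (restrict (\<lambda>i. w i \<omega>) {..<k})) =
        expectation (\<lambda>\<omega>. f (w k \<omega>)) * expectation (\<lambda>\<omega>. g (restrict (\<lambda>i. w i \<omega>) {..<k}))"
    using f g by (auto intro: indep_var_integrable indep_var_lebesgue_integral)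
qed

section \<open>The random return of the closed loop\<close>

text \<open>For the closed loop x_0 = x, x_(k+1) = F x_k + w_k this is F x_k, the next state before
  its noise is added. It takes a noise sequence instead of an outcome, so that it can be viewed as a
  measurable function of the noise before time k.\<close>

primrec noise_state :: "real ^ 'n ^ 'n \<Rightarrow> real ^ 'n \<Rightarrow> (nat \<Rightarrow> real ^ 'n) \<Rightarrow> nat \<Rightarrow> real ^ 'n" where
  "noise_state F x v 0 = F *v x"
| "noise_state F x v (Suc k) = F *v (noise_state F x v k + v k)"

lemma noise_state_eq:
  "noise_state F x v k = matrix_pow F (k + 1) *v x + (\<Sum>\<tau><k. matrix_pow F (k - \<tau>) *v v \<tau>)"
proof (induction k)
  case (Suc k)
  have "F *v (\<Sum>\<tau><k. matrix_pow F (k - \<tau>) *v v \<tau>) = (\<Sum>\<tau><k. matrix_pow F (Suc k - \<tau>) *v v \<tau>)"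
    by (simp add: linear_sum[OF matrix_vector_mul_linear] matrix_vector_mul_assoc Suc_diff_le)
  then show ?case
    by (simp add: Suc matrix_vector_right_distrib matrix_vector_mul_assoc)
qed simp

lemma noise_state_restrict: "j \<le> k \<Longrightarrow> noise_state F x (restrict v {..<k}) j = noise_state F x v j"
  by (induction j) auto

lemma measurable_matrix_vector_mult [measurable]:
  fixes A :: "real ^ 'n ^ 'm"
  assumes "f \<in> borel_measurable N"
  shows "(\<lambda>\<omega>. A *v f \<omega>) \<in> borel_measurable N"
  by (rule borel_measurable_continuous_on[OF _ assms]) (simp add: linear_continuous_on linear_linear)

lemma measurable_vec_component [measurable]:
  fixes f :: "'a \<Rightarrow> real ^ 'n"
  assumes "f \<in> borel_measurable N"
  shows "(\<lambda>\<omega>. f \<omega> $ i) \<in> borel_measurable N"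
  by (rule borel_measurable_continuous_on[OF _ assms]) (intro continuous_intros)

lemma measurable_noise_state:
  "j \<le> k \<Longrightarrow> (\<lambda>v. noise_state F x v j) \<in> borel_measurable (PiM {..<k} (\<lambda>_. borel))"
  by (induction j) (auto intro!: measurable_matrix_vector_mult borel_measurable_add measurable_component_singleton)

text \<open>Not centred: the state has mean F^(k+1) x, and it is E (y y^T) that enters E (w . P
  y)^2.\<close>

definition (in prob_space) second_moment :: "('a \<Rightarrow> real ^ 'n) \<Rightarrow> real ^ 'n ^ 'n" where
  "second_moment U = (\<chi> i j. expectation (\<lambda>\<omega>. U \<omega> $ i * U \<omega> $ j))"

lemma matrix_vector_mult_component_mult:
  fixes A :: "real ^ 'n ^ 'm"
  shows "(A *v u) $ i * (A *v v) $ j = (\<Sum>a\<in>UNIV. \<Sum>b\<in>UNIV. A $ i $ a * A $ j $ b * (u $ a * v $ b))"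
  by (simp add: matrix_vector_mult_def sum_product mult_ac)

lemma (in prob_space)
  fixes A :: "real ^ 'n ^ 'm"
  assumes U: "\<And>i j. integrable M (\<lambda>\<omega>. U \<omega> $ i * U \<omega> $ j)"
  shows integrable_second_moment_linear: "integrable M (\<lambda>\<omega>. (A *v U \<omega>) $ i * (A *v U \<omega>) $ j)"
    and second_moment_linear: "second_moment (\<lambda>\<omega>. A *v U \<omega>) = congruence A (second_moment U)"
proof -
  show "integrable M (\<lambda>\<omega>. (A *v U \<omega>) $ i * (A *v U \<omega>) $ j)"
    unfolding matrix_vector_mult_component_mult using U by auto
  have "expectation (\<lambda>\<omega>. (A *v U \<omega>) $ i * (A *v U \<omega>) $ j) =
      (\<Sum>a\<in>UNIV. \<Sum>b\<in>UNIV. A $ i $ a * A $ j $ b * second_moment U $ a $ b)" for i j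
    unfolding matrix_vector_mult_component_mult using U by (simp add: second_moment_def)
  moreover have "congruence A S $ i $ j = (\<Sum>a\<in>UNIV. \<Sum>b\<in>UNIV. A $ i $ a * A $ j $ b * S $ a $ b)" for S i j
    by (subst sum.swap)
      (simp add: congruence_def matrix_matrix_mult_def transpose_def sum_distrib_right sum_distrib_left mult_ac)
  ultimately show "second_moment (\<lambda>\<omega>. A *v U \<omega>) = congruence A (second_moment U)"
    by (simp add: vec_eq_iff second_moment_def[of "\<lambda>\<omega>. A *v U \<omega>"])
qed

lemma inner_matrix_vector_mult_eq:
  fixes P :: "real ^ 'n ^ 'n"
  shows "u \<bullet> (P *v v) = (\<Sum>i\<in>UNIV. \<Sum>j\<in>UNIV. P $ i $ j * (u $ i * v $ j))"
  by (simp add: inner_vec_def matrix_vector_mult_def sum_distrib_left mult_ac)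

section \<open>Standing assumptions; moments of the noise and of the states\<close>

locale closed_loop = prob_space M for M :: "'a measure" +
  fixes F P :: "real ^ 'n ^ 'n" and \<gamma> :: real and w :: "nat \<Rightarrow> 'a \<Rightarrow> real ^ 'n" and W :: "'a \<Rightarrow> real ^ 'n"
  assumes F: "power_bounded F" and P: "transpose P = P"
    and \<gamma>: "0 < \<gamma>" "\<gamma> < 1"
    and indep: "indep_vars (\<lambda>_. borel) w UNIV"
    and W [measurable]: "W \<in> borel_measurable M"
    and ident: "\<And>k. distr M borel (w k) = distr M borel W"
    and symmetric: "distr M borel (\<lambda>\<omega>. - W \<omega>) = distr M borel W"
    and mean_integrable: "integrable M W" and mean_zero: "expectation W = 0"
    and square_integrable: "integrable M (\<lambda>\<omega>. (norm (W \<omega>))\<^sup>2)"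
begin

abbreviation "q v \<equiv> v \<bullet> (P *v v)"
abbreviation "\<Sigma> \<equiv> covariance_matrix M W"
abbreviation "state x k \<omega> \<equiv> noise_state F x (\<lambda>i. w i \<omega>) k"

lemma w_measurable [measurable]: "w k \<in> borel_measurable M"
  using indep by (auto simp: indep_vars_def)

lemma state_measurable [measurable]: "state x k \<in> borel_measurable M"
  by (induction k) auto

lemma q_measurable [measurable]: "f \<in> borel_measurable N \<Longrightarrow> (\<lambda>\<omega>. q (f \<omega>)) \<in> borel_measurable N"
  by (intro borel_measurable_inner measurable_matrix_vector_mult)

lemma
  fixes f :: "real ^ 'n \<Rightarrow> real"
  assumes [measurable]: "f \<in> borel_measurable borel"
  shows integrable_w_iff: "integrable M (\<lambda>\<omega>. f (w k \<omega>)) \<longleftrightarrow> integrable M (\<lambda>\<omega>. f (W \<omega>))"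
    and expectation_w: "expectation (\<lambda>\<omega>. f (w k \<omega>)) = expectation (\<lambda>\<omega>. f (W \<omega>))"
  using integrable_distr_eq[of "w k" M borel f] integrable_distr_eq[of W M borel f]
    integral_distr[of "w k" M borel f] integral_distr[of W M borel f] ident[of k] by auto

lemma integrable_W_component: "integrable M (\<lambda>\<omega>. W \<omega> $ i)"
  using integrable_bounded_linear[OF bounded_linear_vec_nth mean_integrable] .

lemma expectation_W_component: "expectation (\<lambda>\<omega>. W \<omega> $ i) = 0"
  using integral_bounded_linear[OF bounded_linear_vec_nth mean_integrable, of i] mean_zero by simp

lemma integrable_W_square: "integrable M (\<lambda>\<omega>. (W \<omega> $ i)\<^sup>2)"
  by (rule Bochner_Integration.integrable_bound[OF square_integrable])
    (auto simp: abs_le_square_iff[symmetric] component_le_norm_cart)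

lemma integrable_W_mult: "integrable M (\<lambda>\<omega>. W \<omega> $ i * W \<omega> $ j)"
  by (intro integrable_mult_of_squares integrable_W_square) auto

lemma covariance_eq: "\<Sigma> = second_moment W"
  by (simp add: covariance_matrix_def second_moment_def expectation_W_component)

lemma integrable_q: "integrable M (\<lambda>\<omega>. q (W \<omega>))"
  unfolding inner_matrix_vector_mult_eq using integrable_W_mult by auto

lemma expectation_q: "expectation (\<lambda>\<omega>. q (W \<omega>)) = trace (P ** \<Sigma>)"
proof -
  have "expectation (\<lambda>\<omega>. q (W \<omega>)) = (\<Sum>i\<in>UNIV. \<Sum>j\<in>UNIV. P $ i $ j * \<Sigma> $ j $ i)"
    unfolding inner_matrix_vector_mult_eq covariance_eq
    using integrable_W_mult by (simp add: second_moment_def mult.commute)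
  then show ?thesis by (simp add: trace_def matrix_matrix_mult_def)
qed

text \<open>The integrand is odd in \<open>W\<close>, so by symmetry its expectation equals its own
  negative. Without integrability the integral is 0 by default; where the identity is used,
  integrability is established separately.\<close>

lemma expectation_odd: "expectation (\<lambda>\<omega>. W \<omega> $ i * (q (W \<omega>) - c)) = 0"
proof -
  define f where "f v = v $ i * (q v - c)" for v :: "real ^ 'n"
  have [measurable]: "f \<in> borel_measurable borel"
    unfolding f_def by (intro borel_measurable_times measurable_vec_component borel_measurable_diff
      q_measurable measurable_ident_sets borel_measurable_const) auto
  have "expectation (\<lambda>\<omega>. f (W \<omega>)) = expectation (\<lambda>\<omega>. f (- W \<omega>))"
    using integral_distr[of W M borel f] integral_distr[of "\<lambda>\<omega>. - W \<omega>" M borel f] symmetric by simp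
  also have "(\<lambda>\<omega>. f (- W \<omega>)) = (\<lambda>\<omega>. - f (W \<omega>))"
    by (auto simp: f_def linear_neg[OF matrix_vector_mul_linear])
  finally show ?thesis by (simp add: f_def)
qed

text \<open>The form in which independence is applied: \<open>g\<close> lives on whole sequences but
  looks only at the first k entries, as \<open>g_restrict\<close> says, and the factor in
  \<open>w k\<close> is evaluated at \<open>W\<close>, which has the same distribution.\<close>

lemma
  fixes f :: "real ^ 'n \<Rightarrow> real" and g :: "(nat \<Rightarrow> real ^ 'n) \<Rightarrow> real"
  assumes f [measurable]: "f \<in> borel_measurable borel" and fW: "integrable M (\<lambda>\<omega>. f (W \<omega>))"
    and g: "g \<in> borel_measurable (PiM {..<k} (\<lambda>_. borel))"
    and g_restrict: "\<And>v. g (restrict v {..<k}) = g v"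
    and gw: "integrable M (\<lambda>\<omega>. g (\<lambda>i. w i \<omega>))"
  shows integrable_mult_past: "integrable M (\<lambda>\<omega>. f (w k \<omega>) * g (\<lambda>i. w i \<omega>))"
    and expectation_mult_past: "expectation (\<lambda>\<omega>. f (w k \<omega>) * g (\<lambda>i. w i \<omega>)) =
      expectation (\<lambda>\<omega>. f (W \<omega>)) * expectation (\<lambda>\<omega>. g (\<lambda>i. w i \<omega>))"
  using integrable_mult_indep_past[OF indep f _ g] expectation_mult_indep_past[OF indep f _ g]
    fW gw by (simp_all add: integrable_w_iff expectation_w g_restrict)

lemma noise_state_component_measurable:
  "(\<lambda>v. noise_state F x v k $ i) \<in> borel_measurable (PiM {..<k} (\<lambda>_. borel))"
  by (intro measurable_vec_component measurable_noise_state order_refl)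

text \<open>In the second moment of y_k + w_k the mixed products have expectation zero, because w_k
  is centred and independent of y_k; applying F turns the moment into its congruence. Integrability
  is part of the induction, since the expectation may be split only over integrable
  products.\<close>

lemma state_moments:
  "(\<forall>i j. integrable M (\<lambda>\<omega>. state x k \<omega> $ i * state x k \<omega> $ j)) \<and>
    second_moment (state x k) = second_moment_seq F (outer_product x x) \<Sigma> k"
proof (induction k)
  case 0
  have "second_moment (\<lambda>\<omega>. x) = outer_product x x"
    by (simp add: second_moment_def outer_product_def prob_space)
  then show ?case
    using second_moment_linear[of "\<lambda>_. x" F] integrable_second_moment_linear[of "\<lambda>_. x" F] by simp
next
  case (Suc k)
  let ?s = "state x k"
  have ss: "integrable M (\<lambda>\<omega>. ?s \<omega> $ i * ?s \<omega> $ j)" for i j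
    using Suc by blast
  have s: "integrable M (\<lambda>\<omega>. ?s \<omega> $ i)" for i
    using square_integrable_imp_integrable[of "\<lambda>\<omega>. ?s \<omega> $ i"] ss[of i i] by (simp add: power2_eq_square)
  have comp: "(\<lambda>v. v $ i :: real) \<in> borel_measurable borel" for i :: 'n
    by (intro measurable_vec_component measurable_ident_sets[OF refl])
  have restr: "noise_state F x (restrict v {..<k}) k $ i = noise_state F x v k $ i" for v i
    by (simp only: noise_state_restrict order_refl)
  note past = comp integrable_W_component noise_state_component_measurable restr s
  have ws: "integrable M (\<lambda>\<omega>. w k \<omega> $ i * ?s \<omega> $ j)" for i j
    by (rule integrable_mult_past[OF past])
  have ws0: "expectation (\<lambda>\<omega>. w k \<omega> $ i * ?s \<omega> $ j) = 0" for i j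
    using expectation_mult_past[OF past, of i j] unfolding expectation_W_component mult_zero_left .
  have comp2: "(\<lambda>v. v $ i * v $ j :: real) \<in> borel_measurable borel" for i j :: 'n
    by (intro borel_measurable_times comp)
  have ww: "integrable M (\<lambda>\<omega>. w k \<omega> $ i * w k \<omega> $ j)" for i j
    using integrable_w_iff[OF comp2] integrable_W_mult by blast
  have www: "expectation (\<lambda>\<omega>. w k \<omega> $ i * w k \<omega> $ j) = \<Sigma> $ i $ j" for i j
    using expectation_w[OF comp2[of i j]] by (simp add: covariance_eq second_moment_def)
  have expand: "(?s \<omega> + w k \<omega>) $ i * (?s \<omega> + w k \<omega>) $ j =
      ?s \<omega> $ i * ?s \<omega> $ j + w k \<omega> $ j * ?s \<omega> $ i + w k \<omega> $ i * ?s \<omega> $ j + w k \<omega> $ i * w k \<omega> $ j" for \<omega> i j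
    by (simp add: algebra_simps)
  have U: "integrable M (\<lambda>\<omega>. (?s \<omega> + w k \<omega>) $ i * (?s \<omega> + w k \<omega>) $ j)" for i j
    unfolding expand by (intro Bochner_Integration.integrable_add ss ws ww)
  have "second_moment (\<lambda>\<omega>. ?s \<omega> + w k \<omega>) $ i $ j = (second_moment ?s + \<Sigma>) $ i $ j" for i j
  proof -
    have "second_moment (\<lambda>\<omega>. ?s \<omega> + w k \<omega>) $ i $ j = expectation (\<lambda>\<omega>. ?s \<omega> $ i * ?s \<omega> $ j) +
        expectation (\<lambda>\<omega>. w k \<omega> $ j * ?s \<omega> $ i) + expectation (\<lambda>\<omega>. w k \<omega> $ i * ?s \<omega> $ j) + \<Sigma> $ i $ j"
      unfolding second_moment_def vec_lambda_beta expand www[symmetric]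
      by (simp only: Bochner_Integration.integral_add Bochner_Integration.integrable_add ss ws ww)
    then show ?thesis
      unfolding ws0 by (simp add: second_moment_def[of ?s])
  qed
  then have "second_moment (\<lambda>\<omega>. ?s \<omega> + w k \<omega>) = second_moment_seq F (outer_product x x) \<Sigma> k + \<Sigma>"
    using Suc by (simp add: vec_eq_iff)
  then show ?case
    using second_moment_linear[of "\<lambda>\<omega>. ?s \<omega> + w k \<omega>" F, OF U]
      integrable_second_moment_linear[of "\<lambda>\<omega>. ?s \<omega> + w k \<omega>" F, OF U] by simp
qed

lemmas integrable_state_mult = state_moments[THEN conjunct1, rule_format]
lemmas second_moment_state = state_moments[THEN conjunct2]

lemma integrable_state: "integrable M (\<lambda>\<omega>. state x k \<omega> $ i)"
proof (rule square_integrable_imp_integrable)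
  show "integrable M (\<lambda>\<omega>. (state x k \<omega> $ i)\<^sup>2)"
    unfolding power2_eq_square by (rule integrable_state_mult)
qed measurable

section \<open>The martingale differences\<close>

text \<open>Like the state, a function of the noise sequence, so that partial sums can serve as
  functions of the past. The subtracted trace is the mean of \<open>q (W \<omega>)\<close>; the
  subtracted constants add up to \<gamma> / (1 - \<gamma>) tr (P \<Sigma>), which reappears in the
  mean of the return.\<close>

definition increment :: "real ^ 'n \<Rightarrow> (nat \<Rightarrow> real ^ 'n) \<Rightarrow> nat \<Rightarrow> real" where
  "increment x v k = \<gamma> ^ (k + 1) * (2 * (v k \<bullet> (P *v noise_state F x v k)) + (q (v k) - trace (P ** \<Sigma>)))"

abbreviation "incr x k \<omega> \<equiv> increment x (\<lambda>i. w i \<omega>) k"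

lemma incr_measurable [measurable]: "incr x k \<in> borel_measurable M"
  unfolding increment_def by measurable

lemma measurable_increment: "k < N \<Longrightarrow> (\<lambda>v. increment x v k) \<in> borel_measurable (PiM {..<N} (\<lambda>_. borel))"
  unfolding increment_def
  by (intro borel_measurable_times borel_measurable_add borel_measurable_diff borel_measurable_inner
      q_measurable measurable_matrix_vector_mult measurable_noise_state measurable_component_singleton) auto

lemma increment_restrict: "k < N \<Longrightarrow> increment x (restrict v {..<N}) k = increment x v k"
  by (simp add: increment_def noise_state_restrict)

text \<open>The martingale difference property, tested against functions g of the past. The
  increment is affine in the state with centred coefficients depending on w_k, so g and each product
  of a state component with g must be integrable. This covers g = 1, bounded g and square integrable
  g.\<close>

lemma
  assumes g: "g \<in> borel_measurable (PiM {..<k} (\<lambda>_. borel))" "\<And>v. g (restrict v {..<k}) = g v"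
    and gw: "integrable M (\<lambda>\<omega>. g (\<lambda>i. w i \<omega>))"
    and gs: "\<And>j. integrable M (\<lambda>\<omega>. state x k \<omega> $ j * g (\<lambda>i. w i \<omega>))"
  shows integrable_incr_mult_past: "integrable M (\<lambda>\<omega>. incr x k \<omega> * g (\<lambda>i. w i \<omega>))"
    and expectation_incr_mult_past: "expectation (\<lambda>\<omega>. incr x k \<omega> * g (\<lambda>i. w i \<omega>)) = 0"
proof -
  let ?g = "\<lambda>\<omega>. g (\<lambda>i. w i \<omega>)"
  have comp: "(\<lambda>v. v $ i :: real) \<in> borel_measurable borel" for i :: 'n
    by (intro measurable_vec_component measurable_ident_sets[OF refl])
  have m: "(\<lambda>v. noise_state F x v k $ j * g v) \<in> borel_measurable (PiM {..<k} (\<lambda>_. borel))" for j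
    by (intro borel_measurable_times noise_state_component_measurable g)
  have restr: "noise_state F x (restrict v {..<k}) k $ i * g (restrict v {..<k}) = noise_state F x v k $ i * g v" for v i
    by (simp only: noise_state_restrict order_refl g)
  note past = comp integrable_W_component m restr gs
  have a: "integrable M (\<lambda>\<omega>. w k \<omega> $ i * (state x k \<omega> $ j * ?g \<omega>))" for i j
    by (rule integrable_mult_past[OF past])
  have a0: "expectation (\<lambda>\<omega>. w k \<omega> $ i * (state x k \<omega> $ j * ?g \<omega>)) = 0" for i j
    using expectation_mult_past[OF past, of i j] unfolding expectation_W_component mult_zero_left .
  have qm: "(\<lambda>v. q v - trace (P ** \<Sigma>)) \<in> borel_measurable borel"
    by (intro borel_measurable_diff q_measurable measurable_ident_sets[OF refl]) auto
  have qi: "integrable M (\<lambda>\<omega>. q (W \<omega>) - trace (P ** \<Sigma>))" using integrable_q by simp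
  have b: "integrable M (\<lambda>\<omega>. (q (w k \<omega>) - trace (P ** \<Sigma>)) * ?g \<omega>)"
    by (rule integrable_mult_past[OF qm qi g gw])
  have "expectation (\<lambda>\<omega>. q (W \<omega>) - trace (P ** \<Sigma>)) = 0"
    using integrable_q by (simp add: expectation_q prob_space)
  then have b0: "expectation (\<lambda>\<omega>. (q (w k \<omega>) - trace (P ** \<Sigma>)) * ?g \<omega>) = 0"
    using expectation_mult_past[OF qm qi g gw] by simp
  \<comment> \<open>Entrywise, each summand is a function of \<open>w k\<close> times a function of
    the past, so independence applies term by term.\<close>
  have eq: "incr x k \<omega> * ?g \<omega> =
      \<gamma> ^ (k + 1) * (2 * (\<Sum>i\<in>UNIV. \<Sum>j\<in>UNIV. P $ i $ j * (w k \<omega> $ i * (state x k \<omega> $ j * ?g \<omega>)))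
        + (q (w k \<omega>) - trace (P ** \<Sigma>)) * ?g \<omega>)" for \<omega>
    by (simp add: increment_def inner_matrix_vector_mult_eq[of "w k \<omega>" P "state x k \<omega>"]
        distrib_right sum_distrib_right mult.assoc)
  show "integrable M (\<lambda>\<omega>. incr x k \<omega> * ?g \<omega>)"
    unfolding eq by (intro integrable_mult_right Bochner_Integration.integrable_add Bochner_Integration.integrable_sum a b)
  have "expectation (\<lambda>\<omega>. \<Sum>i\<in>UNIV. \<Sum>j\<in>UNIV. P $ i $ j * (w k \<omega> $ i * (state x k \<omega> $ j * ?g \<omega>))) = 0"
    using a by (simp add: a0 Bochner_Integration.integrable_sum)
  then show "expectation (\<lambda>\<omega>. incr x k \<omega> * ?g \<omega>) = 0"
    unfolding eq
    by (subst Bochner_Integration.integral_mult_right_zero, subst Bochner_Integration.integral_add)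
      (auto intro!: Bochner_Integration.integrable_sum a b simp: b0)
qed

lemma incr_integrable: "integrable M (incr x k)"
proof -
  have "integrable M (\<lambda>\<omega>. incr x k \<omega> * 1)"
    by (rule integrable_incr_mult_past[where g = "\<lambda>_. 1"]) (simp_all add: integrable_state)
  then show ?thesis by simp
qed

lemma incr_expectation: "expectation (incr x k) = 0"
proof -
  have "expectation (\<lambda>\<omega>. incr x k \<omega> * 1) = 0"
    by (rule expectation_incr_mult_past[where g = "\<lambda>_. 1"]) (simp_all add: integrable_state)
  then show ?thesis by simp
qed

text \<open>With u = P y_k the square is the sum of w_i w_j u_i u_j. Independence factors its
  expectation into entries of \<Sigma> and of P Y_k P, and the trace of \<Sigma> P Y_k P is rotated
  cyclically.\<close>

lemma
  shows integrable_inner_square: "integrable M (\<lambda>\<omega>. (w k \<omega> \<bullet> (P *v state x k \<omega>))\<^sup>2)"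
    and expectation_inner_square: "expectation (\<lambda>\<omega>. (w k \<omega> \<bullet> (P *v state x k \<omega>))\<^sup>2) =
      trace (P ** \<Sigma> ** P ** second_moment_seq F (outer_product x x) \<Sigma> k)"
proof -
  let ?u = "\<lambda>\<omega>. P *v state x k \<omega>"
  let ?Y = "second_moment_seq F (outer_product x x) \<Sigma> k"
  have uu: "integrable M (\<lambda>\<omega>. ?u \<omega> $ i * ?u \<omega> $ j)" for i j
    by (rule integrable_second_moment_linear) (rule integrable_state_mult)
  have uuE: "second_moment ?u = congruence P ?Y"
    by (subst second_moment_linear) (auto simp: integrable_state_mult second_moment_state)
  have f: "(\<lambda>v. v $ i * v $ j :: real) \<in> borel_measurable borel" for i j :: 'n
    by (intro borel_measurable_times measurable_vec_component measurable_ident_sets[OF refl])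
  have g: "(\<lambda>v. (P *v noise_state F x v k) $ i * (P *v noise_state F x v k) $ j)
      \<in> borel_measurable (PiM {..<k} (\<lambda>_. borel))" for i j
    by (intro borel_measurable_times measurable_vec_component measurable_matrix_vector_mult
        measurable_noise_state order_refl)
  have restr: "(P *v noise_state F x (restrict v {..<k}) k) $ i * (P *v noise_state F x (restrict v {..<k}) k) $ j =
      (P *v noise_state F x v k) $ i * (P *v noise_state F x v k) $ j" for v i j
    by (simp only: noise_state_restrict order_refl)
  note past = f integrable_W_mult g restr uu
  have a: "integrable M (\<lambda>\<omega>. (w k \<omega> $ i * w k \<omega> $ j) * (?u \<omega> $ i * ?u \<omega> $ j))" for i j
    by (rule integrable_mult_past[OF past])
  have a0: "expectation (\<lambda>\<omega>. (w k \<omega> $ i * w k \<omega> $ j) * (?u \<omega> $ i * ?u \<omega> $ j)) =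
      \<Sigma> $ i $ j * congruence P ?Y $ i $ j" for i j
  proof -
    have "expectation (\<lambda>\<omega>. ?u \<omega> $ i * ?u \<omega> $ j) = congruence P ?Y $ i $ j"
      unfolding uuE[symmetric] second_moment_def vec_lambda_beta ..
    moreover have "expectation (\<lambda>\<omega>. W \<omega> $ i * W \<omega> $ j) = \<Sigma> $ i $ j"
      unfolding covariance_eq second_moment_def vec_lambda_beta ..
    ultimately show ?thesis
      by (simp only: expectation_mult_past[OF past])
  qed
  have eq: "(w k \<omega> \<bullet> ?u \<omega>)\<^sup>2 = (\<Sum>i\<in>UNIV. \<Sum>j\<in>UNIV. (w k \<omega> $ i * w k \<omega> $ j) * (?u \<omega> $ i * ?u \<omega> $ j))" for \<omega>
    by (simp add: power2_eq_square inner_vec_def sum_product mult_ac)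
  show "integrable M (\<lambda>\<omega>. (w k \<omega> \<bullet> ?u \<omega>)\<^sup>2)"
    unfolding eq by (intro Bochner_Integration.integrable_sum a)
  have "\<Sigma> $ i $ j = \<Sigma> $ j $ i" for i j
    unfolding covariance_eq by (simp add: second_moment_def mult.commute)
  \<comment> \<open>The expectation pairs equal index positions, a trace pairs transposed ones;
    symmetry of \<Sigma> reconciles them.\<close>
  then have sym: "(\<Sum>i\<in>UNIV. \<Sum>j\<in>UNIV. \<Sigma> $ i $ j * C $ j $ i) = (\<Sum>i\<in>UNIV. \<Sum>j\<in>UNIV. \<Sigma> $ i $ j * C $ i $ j)" for C :: "real ^ 'n ^ 'n"
    by (subst sum.swap) simp
  have "expectation (\<lambda>\<omega>. (w k \<omega> \<bullet> ?u \<omega>)\<^sup>2) = trace (\<Sigma> ** congruence P ?Y)"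
    unfolding eq trace_def matrix_matrix_mult_def vec_lambda_beta
    unfolding sym using a by (simp add: a0 Bochner_Integration.integrable_sum)
  also have "\<dots> = trace (\<Sigma> ** P ** ?Y ** P)"
    by (simp add: congruence_def P matrix_mul_assoc)
  also have "\<dots> = trace (P ** (\<Sigma> ** P ** ?Y))"
    by (rule trace_mul_sym)
  finally show "expectation (\<lambda>\<omega>. (w k \<omega> \<bullet> ?u \<omega>)\<^sup>2) = trace (P ** \<Sigma> ** P ** ?Y)"
    by (simp add: matrix_mul_assoc)
qed

lemma bounded_linear_trace_mult:
  "bounded_linear (\<lambda>Z. trace (C ** Z :: real ^ 'm ^ 'm))"
  unfolding linear_conv_bounded_linear[symmetric]
  by (rule linearI) (simp_all add: trace_def matrix_matrix_mult_def distrib_left sum.distrib sum_distrib_left mult_ac)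

lemma integrable_inner: "integrable M (\<lambda>\<omega>. w k \<omega> \<bullet> (P *v state x k \<omega>))"
  by (rule square_integrable_imp_integrable[OF _ integrable_inner_square]) measurable

text \<open>The bound |a| <= 1 + a^2 reduces first moments to the known second moments; with the
  weight \<gamma>^(k+1) these are summable by the discounted moment series for g = \<gamma>.\<close>

lemma summable_inner:
  "summable (\<lambda>k. expectation (\<lambda>\<omega>. \<bar>\<gamma> ^ (k + 1) * (w k \<omega> \<bullet> (P *v state x k \<omega>))\<bar>))"
proof (rule summable_comparison_test'[of _ 0])
  let ?Y = "second_moment_seq F (outer_product x x) \<Sigma>"
  let ?t = "\<lambda>Z. trace (P ** \<Sigma> ** P ** Z)"
  have "summable (\<lambda>k. ?t (\<gamma> ^ k *\<^sub>R ?Y k))"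
    using bounded_linear.summable[OF bounded_linear_trace_mult summable_second_moment_seq[OF F]] \<gamma> by simp
  then have "summable (\<lambda>k. \<gamma> ^ k * ?t (?Y k))"
    by (simp add: linear_scale[OF bounded_linear.linear[OF bounded_linear_trace_mult]])
  then show "summable (\<lambda>k. \<gamma> * (\<gamma> ^ k + \<gamma> ^ k * ?t (?Y k)))"
    using \<gamma> by (intro summable_mult summable_add summable_geometric) auto
  fix k
  have "expectation (\<lambda>\<omega>. \<bar>w k \<omega> \<bullet> (P *v state x k \<omega>)\<bar>) \<le> expectation (\<lambda>\<omega>. 1 + (w k \<omega> \<bullet> (P *v state x k \<omega>))\<^sup>2)"
  proof (rule integral_mono)
    have "\<bar>a\<bar> \<le> 1 + a\<^sup>2" for a :: real
      using sum_squares_bound[of "\<bar>a\<bar>" 1] zero_le_power2[of a] by simp 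
    then show "\<bar>w k \<omega> \<bullet> (P *v state x k \<omega>)\<bar> \<le> 1 + (w k \<omega> \<bullet> (P *v state x k \<omega>))\<^sup>2" for \<omega> .
  qed (use integrable_inner integrable_inner_square in auto)
  also have "\<dots> = 1 + ?t (?Y k)"
    using integrable_inner_square by (simp add: expectation_inner_square prob_space)
  finally have "\<gamma> ^ (k + 1) * expectation (\<lambda>\<omega>. \<bar>w k \<omega> \<bullet> (P *v state x k \<omega>)\<bar>) \<le> \<gamma> ^ (k + 1) * (1 + ?t (?Y k))"
    using \<gamma> by (intro mult_left_mono) auto
  then show "norm (expectation (\<lambda>\<omega>. \<bar>\<gamma> ^ (k + 1) * (w k \<omega> \<bullet> (P *v state x k \<omega>))\<bar>)) \<le> \<gamma> * (\<gamma> ^ k + \<gamma> ^ k * ?t (?Y k))"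
    using \<gamma> by (simp add: abs_mult algebra_simps)
qed

lemma summable_q: "summable (\<lambda>k. expectation (\<lambda>\<omega>. \<bar>\<gamma> ^ (k + 1) * q (w k \<omega>)\<bar>))"
proof -
  have "(\<lambda>v. \<bar>q v\<bar>) \<in> borel_measurable borel"
    by (intro borel_measurable_abs q_measurable measurable_ident_sets[OF refl])
  then have "expectation (\<lambda>\<omega>. \<bar>\<gamma> ^ (k + 1) * q (w k \<omega>)\<bar>) = \<gamma> ^ k * (\<gamma> * expectation (\<lambda>\<omega>. \<bar>q (W \<omega>)\<bar>))" for k
    using \<gamma> expectation_w[of "\<lambda>v. \<bar>q v\<bar>" k] by (simp add: abs_mult)
  then show ?thesis
    using \<gamma> by (simp add: summable_mult2 summable_geometric)
qed

lemma integrable_q_w: "integrable M (\<lambda>\<omega>. q (w k \<omega>))"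
  by (rule iffD2[OF integrable_w_iff integrable_q]) (intro q_measurable measurable_ident_sets refl)

text \<open>\<open>q\<close> is quadratic, so second moments of the noise control the first moment
  of every increment. This is what keeps the return integrable even when its variance is
  infinite.\<close>

lemma summable_incr: "summable (\<lambda>k. expectation (\<lambda>\<omega>. \<bar>incr x k \<omega>\<bar>))"
proof (rule summable_comparison_test'[of _ 0])
  let ?a = "\<lambda>k \<omega>. \<gamma> ^ (k + 1) * (w k \<omega> \<bullet> (P *v state x k \<omega>))"
  let ?b = "\<lambda>k \<omega>. \<gamma> ^ (k + 1) * q (w k \<omega>)"
  let ?c = "\<lambda>k. \<gamma> ^ (k + 1) * \<bar>trace (P ** \<Sigma>)\<bar>"
  have "summable (\<lambda>k. \<gamma> ^ (k + 1))"
    using \<gamma> by (subst summable_iff_shift) (simp add: summable_geometric)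
  then show "summable (\<lambda>k. 2 * expectation (\<lambda>\<omega>. \<bar>?a k \<omega>\<bar>) + expectation (\<lambda>\<omega>. \<bar>?b k \<omega>\<bar>) + ?c k)"
    by (intro summable_add summable_mult summable_mult2 summable_inner summable_q)
  fix k
  have "expectation (\<lambda>\<omega>. \<bar>incr x k \<omega>\<bar>) \<le> expectation (\<lambda>\<omega>. 2 * \<bar>?a k \<omega>\<bar> + \<bar>?b k \<omega>\<bar> + ?c k)"
  proof (rule integral_mono)
    fix \<omega>
    have "incr x k \<omega> = 2 * ?a k \<omega> + ?b k \<omega> - \<gamma> ^ (k + 1) * trace (P ** \<Sigma>)"
      unfolding increment_def by (simp add: algebra_simps)
    moreover have "\<bar>\<gamma> ^ (k + 1) * trace (P ** \<Sigma>)\<bar> = ?c k"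
      using \<gamma> by (simp add: abs_mult)
    ultimately show "\<bar>incr x k \<omega>\<bar> \<le> 2 * \<bar>?a k \<omega>\<bar> + \<bar>?b k \<omega>\<bar> + ?c k"
      by linarith
  qed (use incr_integrable integrable_inner integrable_q_w in auto)
  also have "\<dots> = 2 * expectation (\<lambda>\<omega>. \<bar>?a k \<omega>\<bar>) + expectation (\<lambda>\<omega>. \<bar>?b k \<omega>\<bar>) + ?c k"
    using integrable_inner integrable_q_w by (simp add: prob_space)
  finally show "norm (expectation (\<lambda>\<omega>. \<bar>incr x k \<omega>\<bar>)) \<le> 2 * expectation (\<lambda>\<omega>. \<bar>?a k \<omega>\<bar>) + expectation (\<lambda>\<omega>. \<bar>?b k \<omega>\<bar>) + ?c k"
    by simp
qed

section \<open>The return as a constant plus a martingale limit\<close>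

lemma random_return_measurable [measurable]: "random_return \<gamma> F P x w \<in> borel_measurable M"
  unfolding random_return_def
  by (intro borel_measurable_add borel_measurable_times borel_measurable_const borel_measurable_suminf
      borel_measurable_inner measurable_matrix_vector_mult borel_measurable_sum w_measurable)

lemma \<gamma>_powers_sums: "(\<lambda>k. \<gamma> ^ (k + 1)) sums (\<gamma> / (1 - \<gamma>))"
  using sums_mult[OF geometric_sums[of \<gamma>], of \<gamma>] \<gamma> by simp

lemma AE_summable_inner: "AE \<omega> in M. summable (\<lambda>k. \<gamma> ^ (k + 1) * (w k \<omega> \<bullet> (P *v state x k \<omega>)))"
proof -
  have "AE \<omega> in M. summable (\<lambda>k. norm (\<gamma> ^ (k + 1) * (w k \<omega> \<bullet> (P *v state x k \<omega>))))"
    using summable_inner integrable_inner by (intro AE_summable_norm) auto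
  then show ?thesis by eventually_elim (rule summable_norm_cancel)
qed

lemma AE_summable_q: "AE \<omega> in M. summable (\<lambda>k. \<gamma> ^ (k + 1) * q (w k \<omega>))"
proof -
  have "AE \<omega> in M. summable (\<lambda>k. norm (\<gamma> ^ (k + 1) * q (w k \<omega>)))"
    using summable_q integrable_q_w by (intro AE_summable_norm) auto
  then show ?thesis by eventually_elim (rule summable_norm_cancel)
qed

text \<open>
  By linearity of \<open>noise_state_eq\<close>, the summand with \<open>state x k\<close> is the one of the first series of
  the return plus that of the third, and the latter is the case \<open>x = 0\<close>.
\<close>

lemma AE_random_return_eq:
  "AE \<omega> in M. random_return \<gamma> F P x w \<omega> = q x + \<gamma> / (1 - \<gamma>) * trace (P ** \<Sigma>) + (\<Sum>k. incr x k \<omega>)"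
  using AE_summable_inner[of x] AE_summable_inner[of 0] AE_summable_q
proof eventually_elim
  fix \<omega>
  let ?s = "\<lambda>x k. \<gamma> ^ (k + 1) * (w k \<omega> \<bullet> (P *v state x k \<omega>))"
  let ?L = "\<lambda>k. \<gamma> ^ (k + 1) * (w k \<omega> \<bullet> (P *v (matrix_pow F (k + 1) *v x)))"
  let ?D = "\<lambda>k. \<gamma> ^ (k + 1) * q (w k \<omega>)"
  let ?C = "\<lambda>k. \<gamma> ^ (k + 1) * (w k \<omega> \<bullet> (P *v (\<Sum>\<tau><k. matrix_pow F (k - \<tau>) *v w \<tau> \<omega>)))"
  assume s: "summable (?s x)" and s0: "summable (?s 0)" and D: "summable ?D"
  have C: "?s 0 = ?C"
    by (simp add: noise_state_eq)
  have split: "?s x = (\<lambda>k. ?L k + ?C k)"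
    by (simp add: noise_state_eq matrix_vector_right_distrib inner_add_right distrib_left)
  have L_eq: "?L k = ?s x k - ?C k" for k
    using fun_cong[OF split, of k] by linarith
  have L: "summable ?L"
    unfolding L_eq by (rule summable_diff[OF s s0[unfolded C]])
  have "incr x k \<omega> = 2 * ?L k + ?D k + 2 * ?C k - \<gamma> ^ (k + 1) * trace (P ** \<Sigma>)" for k
    using fun_cong[OF split, of k] by (simp add: increment_def algebra_simps)
  moreover have "(\<lambda>k. 2 * ?L k + ?D k + 2 * ?C k - \<gamma> ^ (k + 1) * trace (P ** \<Sigma>)) sums
      (2 * suminf ?L + suminf ?D + 2 * suminf ?C - \<gamma> / (1 - \<gamma>) * trace (P ** \<Sigma>))"
    using s0 unfolding C
    by (intro sums_add sums_diff sums_mult sums_mult2 summable_sums L D \<gamma>_powers_sums)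
  ultimately have "(\<Sum>k. incr x k \<omega>) = 2 * suminf ?L + suminf ?D + 2 * suminf ?C - \<gamma> / (1 - \<gamma>) * trace (P ** \<Sigma>)"
    by (simp only: sums_unique[symmetric])
  then show "random_return \<gamma> F P x w \<omega> = q x + \<gamma> / (1 - \<gamma>) * trace (P ** \<Sigma>) + (\<Sum>k. incr x k \<omega>)"
    unfolding random_return_def by linarith
qed

lemma AE_summable_incr: "AE \<omega> in M. summable (\<lambda>k. norm (incr x k \<omega>))"
  using summable_incr incr_integrable by (intro AE_summable_norm) auto

lemma integrable_suminf_incr: "integrable M (\<lambda>\<omega>. \<Sum>k. incr x k \<omega>)"
  using summable_incr by (intro integrable_suminf incr_integrable AE_summable_incr) simp

lemma expectation_suminf_incr: "expectation (\<lambda>\<omega>. \<Sum>k. incr x k \<omega>) = 0"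
proof -
  have "expectation (\<lambda>\<omega>. \<Sum>k. incr x k \<omega>) = (\<Sum>k. expectation (incr x k))"
    using summable_incr by (intro integral_suminf incr_integrable AE_summable_incr) simp
  then show ?thesis by (simp add: incr_expectation)
qed

lemma suminf_incr_measurable [measurable]: "(\<lambda>\<omega>. \<Sum>k. incr x k \<omega>) \<in> borel_measurable M"
  by (intro borel_measurable_suminf incr_measurable)

lemma integrable_random_return: "integrable M (random_return \<gamma> F P x w)"
  by (subst integrable_cong_AE[OF random_return_measurable _ AE_random_return_eq])
    (simp_all add: integrable_suminf_incr)

lemma expectation_random_return:
  "expectation (random_return \<gamma> F P x w) = q x + \<gamma> / (1 - \<gamma>) * trace (P ** \<Sigma>)"
proof -
  have "expectation (random_return \<gamma> F P x w) =
      expectation (\<lambda>\<omega>. q x + \<gamma> / (1 - \<gamma>) * trace (P ** \<Sigma>) + (\<Sum>k. incr x k \<omega>))"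
    by (rule integral_cong_AE[OF random_return_measurable _ AE_random_return_eq]) measurable
  then show ?thesis
    using integrable_suminf_incr by (simp add: expectation_suminf_incr prob_space)
qed

lemma AE_random_return_centered:
  "AE \<omega> in M. (random_return \<gamma> F P x w \<omega> - expectation (random_return \<gamma> F P x w))\<^sup>2 = (\<Sum>k. incr x k \<omega>)\<^sup>2"
  using AE_random_return_eq[of x] by eventually_elim (simp add: expectation_random_return)

lemma ext_variance_random_return:
  "ext_variance M (random_return \<gamma> F P x w) = enn2ereal (\<integral>\<^sup>+ \<omega>. ennreal ((\<Sum>k. incr x k \<omega>)\<^sup>2) \<partial>M)"
proof -
  have "(\<integral>\<^sup>+ \<omega>. ennreal ((random_return \<gamma> F P x w \<omega> - expectation (random_return \<gamma> F P x w))\<^sup>2) \<partial>M) =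
      (\<integral>\<^sup>+ \<omega>. ennreal ((\<Sum>k. incr x k \<omega>)\<^sup>2) \<partial>M)"
    by (rule nn_integral_cong_AE) (use AE_random_return_centered[of x] in \<open>auto elim: eventually_mono\<close>)
  then show ?thesis
    unfolding ext_variance_def ext_expectation_def by simp
qed

section \<open>The variance as the limit of second moments of partial sums\<close>

lemma measurable_partial_sum:
  "N \<le> k \<Longrightarrow> (\<lambda>v. \<Sum>j<N. increment x v j) \<in> borel_measurable (PiM {..<k} (\<lambda>_. borel))"
  by (intro borel_measurable_sum measurable_increment) auto

lemma partial_sum_restrict:
  "N \<le> k \<Longrightarrow> (\<Sum>j<N. increment x (restrict v {..<k}) j) = (\<Sum>j<N. increment x v j)"
  by (intro sum.cong refl increment_restrict) auto

text \<open>For N <= k the partial sum is a function of the noise before time k, and boundedness of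
  \<phi> makes its products with the state components integrable.\<close>

lemma incr_orthogonal_bounded:
  assumes "N \<le> k" and \<phi>: "\<phi> \<in> borel_measurable borel" "\<And>t. \<bar>\<phi> t\<bar> \<le> b"
  shows "expectation (\<lambda>\<omega>. incr x k \<omega> * \<phi> (\<Sum>j<N. incr x j \<omega>)) = 0"
proof (rule expectation_incr_mult_past[where g = "\<lambda>v. \<phi> (\<Sum>j<N. increment x v j)"])
  have [measurable]: "(\<lambda>\<omega>. \<phi> (\<Sum>j<N. incr x j \<omega>)) \<in> borel_measurable M"
    using \<phi>(1) by measurable
  show "(\<lambda>v. \<phi> (\<Sum>j<N. increment x v j)) \<in> borel_measurable (PiM {..<k} (\<lambda>_. borel))"
    by (rule measurable_compose[OF measurable_partial_sum[OF \<open>N \<le> k\<close>] \<phi>(1)])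
  show "\<phi> (\<Sum>j<N. increment x (restrict v {..<k}) j) = \<phi> (\<Sum>j<N. increment x v j)" for v
    by (simp only: partial_sum_restrict[OF \<open>N \<le> k\<close>])
  show "integrable M (\<lambda>\<omega>. \<phi> (\<Sum>j<N. incr x j \<omega>))"
    by (rule integrable_const_bound[of _ b]) (auto simp: \<phi>(2))
  fix j
  have b: "0 \<le> b" using order_trans[OF abs_ge_zero \<phi>(2)] .
  show "integrable M (\<lambda>\<omega>. state x k \<omega> $ j * \<phi> (\<Sum>j<N. incr x j \<omega>))"
  proof (rule Bochner_Integration.integrable_bound[OF integrable_mult_left[of b, OF integrable_state[of x k j]]])
    show "AE \<omega> in M. norm (state x k \<omega> $ j * \<phi> (\<Sum>j<N. incr x j \<omega>)) \<le> norm (state x k \<omega> $ j * b)"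
      using mult_left_mono[OF \<phi>(2) abs_ge_zero] b by (simp add: abs_mult)
  qed measurable
qed

lemma
  shows nn_integral_incr_le: "(\<integral>\<^sup>+ \<omega>. ennreal ((\<Sum>k<N. incr x k \<omega>)\<^sup>2) \<partial>M) \<le> (\<integral>\<^sup>+ \<omega>. ennreal ((\<Sum>k. incr x k \<omega>)\<^sup>2) \<partial>M)"
    and nn_integral_incr_LIMSEQ: "(\<lambda>N. \<integral>\<^sup>+ \<omega>. ennreal ((\<Sum>k<N. incr x k \<omega>)\<^sup>2) \<partial>M)
      \<longlonglongrightarrow> (\<integral>\<^sup>+ \<omega>. ennreal ((\<Sum>k. incr x k \<omega>)\<^sup>2) \<partial>M)"
  by (rule nn_integral_square_partial_sum_le[OF incr_integrable summable_incr incr_orthogonal_bounded]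
      nn_integral_square_partial_sum_LIMSEQ[OF incr_integrable summable_incr incr_orthogonal_bounded]; assumption)+

text \<open>The partial sum for N = 1 is T_0. Solving T_0 for w_0 . P w_0 leaves T_0 / \<gamma>, a
  constant, and a multiple of w_0 . P F x, which is square integrable because F x is
  deterministic.\<close>

lemma integrable_q_square_if_finite:
  assumes "(\<integral>\<^sup>+ \<omega>. ennreal ((\<Sum>k. incr x k \<omega>)\<^sup>2) \<partial>M) \<noteq> \<infinity>"
  shows "integrable M (\<lambda>\<omega>. (q (W \<omega>))\<^sup>2)"
proof -
  have "(\<integral>\<^sup>+ \<omega>. ennreal ((incr x 0 \<omega>)\<^sup>2) \<partial>M) < \<infinity>"
    using le_less_trans[OF nn_integral_incr_le[of x 1]] assms by (simp add: top.not_eq_extremum)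
  then have i0: "integrable M (\<lambda>\<omega>. (incr x 0 \<omega>)\<^sup>2)"
    by (intro integrableI_nonneg) auto
  let ?d = "\<lambda>\<omega>. 1 / \<gamma> * incr x 0 \<omega>"
  let ?e = "\<lambda>\<omega>. trace (P ** \<Sigma>) - 2 * (w 0 \<omega> \<bullet> (P *v state x 0 \<omega>))"
  have i: "integrable M (\<lambda>\<omega>. w 0 \<omega> \<bullet> (P *v state x 0 \<omega>))" "integrable M (\<lambda>\<omega>. (w 0 \<omega> \<bullet> (P *v state x 0 \<omega>))\<^sup>2)"
    using integrable_inner[of 0 x] integrable_inner_square[of 0 x] by auto
  have d2: "integrable M (\<lambda>\<omega>. (?d \<omega>)\<^sup>2)"
    unfolding power_mult_distrib using i0 by (rule integrable_mult_right)
  have "(?e \<omega>)\<^sup>2 = (trace (P ** \<Sigma>))\<^sup>2 - 4 * trace (P ** \<Sigma>) * (w 0 \<omega> \<bullet> (P *v state x 0 \<omega>))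
      + 4 * (w 0 \<omega> \<bullet> (P *v state x 0 \<omega>))\<^sup>2" for \<omega>
    by (simp add: power2_eq_square algebra_simps)
  then have e2: "integrable M (\<lambda>\<omega>. (?e \<omega>)\<^sup>2)"
    using i by simp
  have de: "integrable M (\<lambda>\<omega>. ?d \<omega> * ?e \<omega>)"
    by (rule integrable_mult_of_squares[OF _ _ d2 e2]) measurable
  have "q (w 0 \<omega>) = ?d \<omega> + ?e \<omega>" for \<omega>
    using \<gamma> by (simp add: increment_def)
  then have "(q (w 0 \<omega>))\<^sup>2 = (?d \<omega>)\<^sup>2 + (?e \<omega>)\<^sup>2 + 2 * (?d \<omega> * ?e \<omega>)" for \<omega>
    by (simp only: power2_sum mult.assoc)
  then have "integrable M (\<lambda>\<omega>. (q (w 0 \<omega>))\<^sup>2)"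
    using d2 e2 de by (simp only: Bochner_Integration.integrable_add integrable_mult_right)
  moreover have m: "(\<lambda>v. (q v)\<^sup>2) \<in> borel_measurable borel"
    by (intro borel_measurable_power q_measurable measurable_ident_sets refl)
  ultimately show ?thesis
    using integrable_w_iff[OF m] by blast
qed

section \<open>The case of square integrable w . P w\<close>

context
  assumes fourth: "integrable M (\<lambda>\<omega>. (q (W \<omega>))\<^sup>2)"
begin

lemma integrable_qc: "integrable M (\<lambda>\<omega>. (q (W \<omega>) - c)\<^sup>2)"
  using fourth integrable_q by (simp add: power2_diff)

text \<open>Write T_k = \<gamma>^(k+1) (2 a + b) with a = w_k . P y_k and b centred. Then E b^2 is
  the variance of w . P w, and a b is a sum of products of an odd function of w_k with a past
  component. The odd functions are integrable by Cauchy-Schwarz, which is where the fourth moment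
  enters.\<close>

lemma
  shows integrable_incr_square: "integrable M (\<lambda>\<omega>. (incr x k \<omega>)\<^sup>2)"
    and expectation_incr_square: "expectation (\<lambda>\<omega>. (incr x k \<omega>)\<^sup>2) = (\<gamma>\<^sup>2) ^ (k + 1) *
      (expectation (\<lambda>\<omega>. (q (W \<omega>))\<^sup>2) - (trace (P ** \<Sigma>))\<^sup>2
        + 4 * trace (P ** \<Sigma> ** P ** second_moment_seq F (outer_product x x) \<Sigma> k))"
proof -
  let ?c = "trace (P ** \<Sigma>)"
  let ?a = "\<lambda>\<omega>. w k \<omega> \<bullet> (P *v state x k \<omega>)"
  let ?b = "\<lambda>\<omega>. q (w k \<omega>) - ?c"
  have bm: "(\<lambda>v. (q v - ?c)\<^sup>2) \<in> borel_measurable borel"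
    by (intro borel_measurable_power borel_measurable_diff q_measurable measurable_ident_sets refl borel_measurable_const)
  have b2: "integrable M (\<lambda>\<omega>. (?b \<omega>)\<^sup>2)"
    by (rule iffD2[OF integrable_w_iff[OF bm] integrable_qc])
  have "expectation (\<lambda>\<omega>. (?b \<omega>)\<^sup>2) = expectation (\<lambda>\<omega>. (q (W \<omega>) - ?c)\<^sup>2)"
    by (rule expectation_w[OF bm])
  also have "\<dots> = expectation (\<lambda>\<omega>. (q (W \<omega>))\<^sup>2) - ?c\<^sup>2"
    using variance_eq[OF integrable_q fourth] by (simp only: expectation_q)
  finally have b2E: "expectation (\<lambda>\<omega>. (?b \<omega>)\<^sup>2) = expectation (\<lambda>\<omega>. (q (W \<omega>))\<^sup>2) - ?c\<^sup>2" .
  have fm: "(\<lambda>v. v $ i * (q v - ?c)) \<in> borel_measurable borel" for i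
    by (intro borel_measurable_times measurable_vec_component borel_measurable_diff q_measurable
        measurable_ident_sets refl borel_measurable_const)
  have fi: "integrable M (\<lambda>\<omega>. W \<omega> $ i * (q (W \<omega>) - ?c))" for i
    by (rule integrable_mult_of_squares[OF _ _ integrable_W_square integrable_qc]) measurable
  have gm: "(\<lambda>v. (P *v noise_state F x v k) $ i) \<in> borel_measurable (PiM {..<k} (\<lambda>_. borel))" for i
    by (intro measurable_vec_component measurable_matrix_vector_mult measurable_noise_state order_refl)
  have restr: "(P *v noise_state F x (restrict v {..<k}) k) $ i = (P *v noise_state F x v k) $ i" for v i
    by (simp only: noise_state_restrict order_refl)
  have gi: "integrable M (\<lambda>\<omega>. (P *v state x k \<omega>) $ i)" for i
    using integrable_state by (simp add: matrix_vector_mult_def)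
  note past = fm fi gm restr gi
  have ab: "integrable M (\<lambda>\<omega>. (w k \<omega> $ i * ?b \<omega>) * (P *v state x k \<omega>) $ i)" for i
    by (rule integrable_mult_past[OF past])
  have ab0: "expectation (\<lambda>\<omega>. (w k \<omega> $ i * ?b \<omega>) * (P *v state x k \<omega>) $ i) = 0" for i
    using expectation_mult_past[OF past, of i i] unfolding expectation_odd mult_zero_left .
  have ab_eq: "?a \<omega> * ?b \<omega> = (\<Sum>i\<in>UNIV. (w k \<omega> $ i * ?b \<omega>) * (P *v state x k \<omega>) $ i)" for \<omega>
    by (simp add: inner_vec_def sum_distrib_right mult_ac)
  have iab: "integrable M (\<lambda>\<omega>. ?a \<omega> * ?b \<omega>)"
    unfolding ab_eq by (intro Bochner_Integration.integrable_sum ab)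
  have Eab: "expectation (\<lambda>\<omega>. ?a \<omega> * ?b \<omega>) = 0"
    unfolding ab_eq by (subst Bochner_Integration.integral_sum) (simp_all only: ab ab0 sum.neutral_const)
  have "(\<gamma> ^ (k + 1))\<^sup>2 = (\<gamma>\<^sup>2) ^ (k + 1)"
    by (metis power_mult mult.commute)
  moreover have "(2 * s + t)\<^sup>2 = 4 * s\<^sup>2 + 4 * (s * t) + t\<^sup>2" for s t :: real
    by (simp add: power2_eq_square algebra_simps)
  ultimately have eq: "(incr x k \<omega>)\<^sup>2 = (\<gamma>\<^sup>2) ^ (k + 1) * (4 * (?a \<omega>)\<^sup>2 + 4 * (?a \<omega> * ?b \<omega>) + (?b \<omega>)\<^sup>2)" for \<omega>
    by (simp only: increment_def power_mult_distrib)
  note int = integrable_inner_square[of k x] iab b2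
  show "integrable M (\<lambda>\<omega>. (incr x k \<omega>)\<^sup>2)"
    unfolding eq by (intro integrable_mult_right Bochner_Integration.integrable_add int)
  have "expectation (\<lambda>\<omega>. 4 * (?a \<omega>)\<^sup>2 + 4 * (?a \<omega> * ?b \<omega>) + (?b \<omega>)\<^sup>2) =
      4 * expectation (\<lambda>\<omega>. (?a \<omega>)\<^sup>2) + 4 * expectation (\<lambda>\<omega>. ?a \<omega> * ?b \<omega>) + expectation (\<lambda>\<omega>. (?b \<omega>)\<^sup>2)"
    by (simp only: Bochner_Integration.integral_add Bochner_Integration.integrable_add
        integrable_mult_right integral_mult_right_zero int)
  then show "expectation (\<lambda>\<omega>. (incr x k \<omega>)\<^sup>2) = (\<gamma>\<^sup>2) ^ (k + 1) *
      (expectation (\<lambda>\<omega>. (q (W \<omega>))\<^sup>2) - ?c\<^sup>2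
        + 4 * trace (P ** \<Sigma> ** P ** second_moment_seq F (outer_product x x) \<Sigma> k))"
    unfolding eq integral_mult_right_zero Eab b2E expectation_inner_square by simp
qed

text \<open>Increments are pairwise orthogonal. The past function is now the unbounded partial sum
  itself; it is square integrable by induction, so its products with increments and states are
  integrable.\<close>

lemma
  shows integrable_partial_sum_square: "integrable M (\<lambda>\<omega>. (\<Sum>k<N. incr x k \<omega>)\<^sup>2)"
    and expectation_partial_sum_square:
      "expectation (\<lambda>\<omega>. (\<Sum>k<N. incr x k \<omega>)\<^sup>2) = (\<Sum>k<N. expectation (\<lambda>\<omega>. (incr x k \<omega>)\<^sup>2))"
proof (induction N)
  case (Suc N)
  let ?S = "\<lambda>\<omega>. \<Sum>k<N. incr x k \<omega>"
  have i: "integrable M (\<lambda>\<omega>. incr x N \<omega> * ?S \<omega>)"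
    by (rule integrable_mult_of_squares[OF _ _ integrable_incr_square Suc(1)]) measurable
  have "expectation (\<lambda>\<omega>. incr x N \<omega> * ?S \<omega>) = 0"
  proof (rule expectation_incr_mult_past[where g = "\<lambda>v. \<Sum>k<N. increment x v k"])
    show "integrable M ?S"
      by (intro Bochner_Integration.integrable_sum incr_integrable)
    show "integrable M (\<lambda>\<omega>. state x N \<omega> $ j * ?S \<omega>)" for j
    proof (rule integrable_mult_of_squares[OF _ _ _ Suc(1)])
      show "integrable M (\<lambda>\<omega>. (state x N \<omega> $ j)\<^sup>2)"
        unfolding power2_eq_square by (rule integrable_state_mult)
    qed measurable
  qed (simp_all only: measurable_partial_sum partial_sum_restrict order_refl)
  moreover have "(\<Sum>k<Suc N. incr x k \<omega>)\<^sup>2 = (?S \<omega>)\<^sup>2 + (incr x N \<omega>)\<^sup>2 + 2 * (incr x N \<omega> * ?S \<omega>)" for \<omega>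
    by (simp add: power2_eq_square algebra_simps)
  moreover note Suc i integrable_incr_square[of x N]
  ultimately show "integrable M (\<lambda>\<omega>. (\<Sum>k<Suc N. incr x k \<omega>)\<^sup>2)"
    and "expectation (\<lambda>\<omega>. (\<Sum>k<Suc N. incr x k \<omega>)\<^sup>2) = (\<Sum>k<Suc N. expectation (\<lambda>\<omega>. (incr x k \<omega>)\<^sup>2))"
    by simp_all
qed simp_all

text \<open>The weights \<gamma>^(2(k+1)) sum to \<gamma>^2 / (1 - \<gamma>^2) on the constant part,
  and linearity of the trace collects the second moments into the series. V is a limit of
  nonnegative expectations; its sign matters because \<open>ennreal\<close> sends negative reals to
  0.\<close>

lemma
  fixes x
  defines "V \<equiv> \<gamma>\<^sup>2 / (1 - \<gamma>\<^sup>2) * expectation (\<lambda>\<omega>. (q (W \<omega>))\<^sup>2) - \<gamma>\<^sup>2 / (1 - \<gamma>\<^sup>2) * (trace (P ** \<Sigma>))\<^sup>2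
      + 4 * \<gamma>\<^sup>2 * trace (P ** \<Sigma> ** P ** (\<Sum>k. (\<gamma>\<^sup>2) ^ k *\<^sub>R second_moment_seq F (outer_product x x) \<Sigma> k))"
  shows nn_integral_suminf_incr: "(\<integral>\<^sup>+ \<omega>. ennreal ((\<Sum>k. incr x k \<omega>)\<^sup>2) \<partial>M) = ennreal V"
    and variance_value_nonneg: "0 \<le> V"
proof -
  let ?Y = "second_moment_seq F (outer_product x x) \<Sigma>"
  let ?t = "\<lambda>Z. trace (P ** \<Sigma> ** P ** Z)"
  let ?v = "expectation (\<lambda>\<omega>. (q (W \<omega>))\<^sup>2) - (trace (P ** \<Sigma>))\<^sup>2"
  have \<gamma>2: "0 \<le> \<gamma>\<^sup>2" "\<gamma>\<^sup>2 < 1"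
    using \<gamma> by (auto simp: power_less_one_iff abs_square_less_1)
  have "(\<lambda>k. ?t ((\<gamma>\<^sup>2) ^ k *\<^sub>R ?Y k)) sums ?t (\<Sum>k. (\<gamma>\<^sup>2) ^ k *\<^sub>R ?Y k)"
    by (intro bounded_linear.sums[OF bounded_linear_trace_mult] summable_sums summable_second_moment_seq F \<gamma>2)
  then have tr: "(\<lambda>k. (\<gamma>\<^sup>2) ^ k * ?t (?Y k)) sums ?t (\<Sum>k. (\<gamma>\<^sup>2) ^ k *\<^sub>R ?Y k)"
    by (simp add: linear_scale[OF bounded_linear.linear[OF bounded_linear_trace_mult]])
  have "(\<lambda>k. \<gamma>\<^sup>2 * ?v * (\<gamma>\<^sup>2) ^ k + 4 * \<gamma>\<^sup>2 * ((\<gamma>\<^sup>2) ^ k * ?t (?Y k))) sums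
      (\<gamma>\<^sup>2 * ?v * (1 / (1 - \<gamma>\<^sup>2)) + 4 * \<gamma>\<^sup>2 * ?t (\<Sum>k. (\<gamma>\<^sup>2) ^ k *\<^sub>R ?Y k))"
    by (intro sums_add sums_mult geometric_sums tr) (use \<gamma>2 in simp)
  moreover have "\<gamma>\<^sup>2 * ?v * (1 / (1 - \<gamma>\<^sup>2)) + 4 * \<gamma>\<^sup>2 * ?t (\<Sum>k. (\<gamma>\<^sup>2) ^ k *\<^sub>R ?Y k) = V"
    by (simp add: V_def right_diff_distrib diff_divide_distrib)
  moreover have "expectation (\<lambda>\<omega>. (incr x k \<omega>)\<^sup>2) = \<gamma>\<^sup>2 * ?v * (\<gamma>\<^sup>2) ^ k + 4 * \<gamma>\<^sup>2 * ((\<gamma>\<^sup>2) ^ k * ?t (?Y k))" for k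
    unfolding expectation_incr_square by (simp add: algebra_simps)
  ultimately have "(\<lambda>k. expectation (\<lambda>\<omega>. (incr x k \<omega>)\<^sup>2)) sums V"
    by simp
  then have lim: "(\<lambda>N. expectation (\<lambda>\<omega>. (\<Sum>k<N. incr x k \<omega>)\<^sup>2)) \<longlonglongrightarrow> V"
    unfolding sums_def expectation_partial_sum_square .
  then show "0 \<le> V"
    by (rule LIMSEQ_le_const) (auto intro!: integral_nonneg_AE)
  have "(\<integral>\<^sup>+ \<omega>. ennreal ((\<Sum>k<N. incr x k \<omega>)\<^sup>2) \<partial>M) = ennreal (expectation (\<lambda>\<omega>. (\<Sum>k<N. incr x k \<omega>)\<^sup>2))" for N
    by (rule nn_integral_eq_integral[OF integrable_partial_sum_square]) simp
  then have "(\<lambda>N. \<integral>\<^sup>+ \<omega>. ennreal ((\<Sum>k<N. incr x k \<omega>)\<^sup>2) \<partial>M) \<longlonglongrightarrow> ennreal V"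
    using tendsto_ennrealI[OF lim] by simp
  then show "(\<integral>\<^sup>+ \<omega>. ennreal ((\<Sum>k. incr x k \<omega>)\<^sup>2) \<partial>M) = ennreal V"
    by (rule LIMSEQ_unique[OF nn_integral_incr_LIMSEQ])
qed

text \<open>For a nonnegative function a finite value of the nonnegative integral gives
  integrability and the value of the Bochner integral at once.\<close>

lemma has_bochner_integral_variance:
  fixes x
  defines "V \<equiv> \<gamma>\<^sup>2 / (1 - \<gamma>\<^sup>2) * expectation (\<lambda>\<omega>. (q (W \<omega>))\<^sup>2) - \<gamma>\<^sup>2 / (1 - \<gamma>\<^sup>2) * (trace (P ** \<Sigma>))\<^sup>2
      + 4 * \<gamma>\<^sup>2 * trace (P ** \<Sigma> ** P ** (\<Sum>k. (\<gamma>\<^sup>2) ^ k *\<^sub>R second_moment_seq F (outer_product x x) \<Sigma> k))"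
  shows "has_bochner_integral M
    (\<lambda>\<omega>. (random_return \<gamma> F P x w \<omega> - expectation (random_return \<gamma> F P x w))\<^sup>2) V"
proof -
  have "has_bochner_integral M (\<lambda>\<omega>. (\<Sum>k. incr x k \<omega>)\<^sup>2) V"
    using nn_integral_suminf_incr[of x] variance_value_nonneg[of x]
    unfolding V_def by (intro has_bochner_integral_nn_integral) auto
  then show ?thesis
    by (subst has_bochner_integral_cong_AE[OF _ _ AE_random_return_centered]) measurable
qed

lemma integrable_random_return_square: "integrable M (\<lambda>\<omega>. (random_return \<gamma> F P x w \<omega>)\<^sup>2)"
proof -
  define m where "m = expectation (random_return \<gamma> F P x w)"
  have eq: "(random_return \<gamma> F P x w \<omega>)\<^sup>2 =
      (random_return \<gamma> F P x w \<omega> - m)\<^sup>2 + 2 * m * random_return \<gamma> F P x w \<omega> - m\<^sup>2" for \<omega>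
    by (simp add: power2_eq_square algebra_simps)
  have "integrable M (\<lambda>\<omega>. (random_return \<gamma> F P x w \<omega> - m)\<^sup>2)"
    using has_bochner_integral_variance[of x] unfolding m_def by (rule integrable.intros)
  then show ?thesis
    unfolding eq
    by (intro Bochner_Integration.integrable_diff Bochner_Integration.integrable_add
        integrable_mult_right integrable_random_return integrable_const)
qed

end

lemma ext_variance_random_return_eq:
  "ext_variance M (random_return \<gamma> F P x w) =
    ereal (\<gamma>\<^sup>2 / (1 - \<gamma>\<^sup>2)) * ext_expectation M (\<lambda>\<omega>. (q (W \<omega>))\<^sup>2)
    - ereal (\<gamma>\<^sup>2 / (1 - \<gamma>\<^sup>2) * (trace (P ** \<Sigma>))\<^sup>2)
    + ereal (4 * \<gamma>\<^sup>2 * trace (P ** \<Sigma> ** P ** (\<Sum>k. (\<gamma>\<^sup>2) ^ k *\<^sub>R second_moment_seq F (outer_product x x) \<Sigma> k)))"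
proof (cases "integrable M (\<lambda>\<omega>. (q (W \<omega>))\<^sup>2)")
  case True
  have "ext_expectation M (\<lambda>\<omega>. (q (W \<omega>))\<^sup>2) = ereal (expectation (\<lambda>\<omega>. (q (W \<omega>))\<^sup>2))"
    unfolding ext_expectation_def by (subst nn_integral_eq_integral[OF True]) auto
  then show ?thesis
    unfolding ext_variance_random_return nn_integral_suminf_incr[OF True]
    using variance_value_nonneg[OF True, of x] by simp
next
  case False
  have "(\<integral>\<^sup>+ \<omega>. ennreal ((\<Sum>k. incr x k \<omega>)\<^sup>2) \<partial>M) = \<infinity>"
    using False integrable_q_square_if_finite by blast
  then have inf: "ext_variance M (random_return \<gamma> F P x w) = \<infinity>"
    by (simp add: ext_variance_random_return)
  have "(\<integral>\<^sup>+ \<omega>. ennreal ((q (W \<omega>))\<^sup>2) \<partial>M) = \<infinity>"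
  proof (rule ccontr)
    assume "(\<integral>\<^sup>+ \<omega>. ennreal ((q (W \<omega>))\<^sup>2) \<partial>M) \<noteq> \<infinity>"
    then have "integrable M (\<lambda>\<omega>. (q (W \<omega>))\<^sup>2)"
      by (intro integrableI_nonneg) (auto simp: top.not_eq_extremum)
    with False show False by blast
  qed
  then have "ext_expectation M (\<lambda>\<omega>. (q (W \<omega>))\<^sup>2) = \<infinity>"
    by (simp add: ext_expectation_def)
  \<comment> \<open>The factor must be strictly positive, since 0 times \<infinity> is 0 in
    \<open>ereal\<close>; then the finite terms leave the value \<infinity>.\<close>
  moreover have "0 < \<gamma>\<^sup>2 / (1 - \<gamma>\<^sup>2)" "\<gamma> \<noteq> 0" "\<gamma>\<^sup>2 \<noteq> 1"
    using \<gamma> by (auto simp: abs_square_less_1 power2_eq_1_iff)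
  ultimately show ?thesis
    using inf by simp
qed

end

text \<open>The extended real identity includes the case where w . P w is not square integrable and
  both sides are infinite; integrability of \<open>G\<close> is what makes
  \<open>ext_variance\<close> meaningful. Definiteness of Z is tied to invertibility of F: if F^T v
  = 0, the Lyapunov equation gives v . Z v = 0.\<close>

theorem theorem1:
  fixes A Q P :: "real ^ 'n ^ 'n" and B :: "real ^ 'm ^ 'n"
    and R :: "real ^ 'm ^ 'm" and K :: "real ^ 'n ^ 'm"
    and \<gamma> :: real and x :: "real ^ 'n"
    and M :: "'a measure" and w :: "nat \<Rightarrow> 'a \<Rightarrow> real ^ 'n" and W :: "'a \<Rightarrow> real ^ 'n"
  defines "F \<equiv> A + B ** K"
  defines "\<Sigma> \<equiv> covariance_matrix M W"
  defines "G \<equiv> random_return \<gamma> F P x w"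
  assumes Q: "sym_pos_def Q" and R: "sym_pos_def R"
    and \<gamma>: "0 < \<gamma>" "\<gamma> < 1"
    and stable: "matrix_spectral_radius F < 1"
    and M: "prob_space M"
    and indep: "prob_space.indep_vars M (\<lambda>_. borel) w UNIV"
    and W: "W \<in> borel_measurable M"
    and ident: "\<And>k. distr M borel (w k) = distr M borel W"
    and symmetric: "distr M borel (\<lambda>\<omega>. - W \<omega>) = distr M borel W"
    and mean: "integrable M W" "(\<integral>\<omega>. W \<omega> \<partial>M) = 0"
    and second_moment: "integrable M (\<lambda>\<omega>. (norm (W \<omega>))\<^sup>2)"
    and cov: "sym_pos_def \<Sigma>"
    and P: "P = Q + transpose K ** R ** K + \<gamma> *\<^sub>R (transpose F ** P ** F)"
  defines "lyapunov \<equiv> \<lambda>Z. Z - \<gamma>\<^sup>2 *\<^sub>R (F ** Z ** transpose F) =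
      F ** (outer_product x x + (\<gamma>\<^sup>2 / (1 - \<gamma>\<^sup>2)) *\<^sub>R \<Sigma>) ** transpose F"
  shows "integrable M G \<and>
    (\<exists>!Z. lyapunov Z) \<and>
    (\<forall>Z. lyapunov Z \<longrightarrow>
       sym_pos_semidef Z \<and> (invertible F \<longrightarrow> sym_pos_def Z) \<and>
       ext_variance M G =
         ereal (\<gamma>\<^sup>2 / (1 - \<gamma>\<^sup>2)) * ext_expectation M (\<lambda>\<omega>. (W \<omega> \<bullet> (P *v W \<omega>))\<^sup>2)
         - ereal (\<gamma>\<^sup>2 / (1 - \<gamma>\<^sup>2) * (trace (P ** \<Sigma>))\<^sup>2)
         + ereal (4 * \<gamma>\<^sup>2 * trace (P ** \<Sigma> ** P ** Z)) \<and>
       (integrable M (\<lambda>\<omega>. (W \<omega> \<bullet> (P *v W \<omega>))\<^sup>2) \<longrightarrow>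
          integrable M (\<lambda>\<omega>. (G \<omega>)\<^sup>2) \<and>
          prob_space.variance M G =
            \<gamma>\<^sup>2 / (1 - \<gamma>\<^sup>2) * prob_space.expectation M (\<lambda>\<omega>. (W \<omega> \<bullet> (P *v W \<omega>))\<^sup>2)
            - \<gamma>\<^sup>2 / (1 - \<gamma>\<^sup>2) * (trace (P ** \<Sigma>))\<^sup>2
            + 4 * \<gamma>\<^sup>2 * trace (P ** \<Sigma> ** P ** Z)))"
proof -
  interpret prob_space M by (rule M)
  have F: "power_bounded F"
    by (rule power_bounded_if_spectral_radius_less_1[OF stable])
  \<comment> \<open>Q and R are symmetric, so P^T solves the equation of P; uniqueness for the Stein
    equation with F^T and g = \<gamma> applies.\<close>
  have "transpose P = P"
  proof (rule stein_unique[OF power_bounded_transpose[OF F]])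
    let ?N = "Q + transpose K ** R ** K"
    show eq: "P - \<gamma> *\<^sub>R congruence (transpose F) P = ?N"
      using P by (simp add: congruence_def algebra_simps)
    have "transpose ?N = ?N"
      using Q R by (simp add: transpose_add matrix_transpose_mul matrix_mul_assoc sym_pos_def_def sym_matrix_def)
    moreover have "P = ?N + \<gamma> *\<^sub>R congruence (transpose F) P"
      using eq by (simp add: algebra_simps)
    ultimately have "transpose P = ?N + \<gamma> *\<^sub>R congruence (transpose F) (transpose P)"
      by (metis transpose_add transpose_congruence transpose_scalar)
    then show "transpose P - \<gamma> *\<^sub>R congruence (transpose F) (transpose P) = ?N"
      by (simp add: algebra_simps)
  qed (use \<gamma> in auto)
  then interpret closed_loop M F P \<gamma> w W
    using F \<gamma> indep W ident symmetric mean second_moment by unfold_locales auto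
  define S where "S = outer_product x x + (\<gamma>\<^sup>2 / (1 - \<gamma>\<^sup>2)) *\<^sub>R \<Sigma>"
  \<comment> \<open>The trace term is computed for this series; uniqueness transfers the result to
    any solution of the Lyapunov equation.\<close>
  define Z\<^sub>0 where "Z\<^sub>0 = (\<Sum>k. (\<gamma>\<^sup>2) ^ k *\<^sub>R second_moment_seq F (outer_product x x) \<Sigma> k)"
  have \<gamma>2: "0 \<le> \<gamma>\<^sup>2" "\<gamma>\<^sup>2 < 1" "0 < \<gamma>\<^sup>2 / (1 - \<gamma>\<^sup>2)"
    using \<gamma> by (auto simp: abs_square_less_1)
  have lyapunov_iff: "lyapunov Z \<longleftrightarrow> Z - \<gamma>\<^sup>2 *\<^sub>R congruence F Z = congruence F S" for Z
    by (simp add: lyapunov_def congruence_def S_def)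
  have Z\<^sub>0: "lyapunov Z\<^sub>0"
    unfolding lyapunov_iff S_def Z\<^sub>0_def by (rule suminf_second_moment_seq[OF F \<gamma>2(1,2)])
  have unique: "Z = Z\<^sub>0" if "lyapunov Z" for Z
    using stein_unique[OF F \<gamma>2(1,2)] that Z\<^sub>0 unfolding lyapunov_iff by blast
  have quad: "v \<bullet> (S *v v) = (x \<bullet> v)\<^sup>2 + \<gamma>\<^sup>2 / (1 - \<gamma>\<^sup>2) * (v \<bullet> (\<Sigma> *v v))" for v
    by (simp add: S_def matrix_vector_mult_add_rdistrib inner_add_right scaleR_matrix_vector_assoc[symmetric]
        inner_outer_product)
  have S_sym: "sym_matrix S"
    using cov by (simp add: S_def sym_matrix_def sym_pos_def_def transpose_add transpose_scalar)
      (simp add: outer_product_def transpose_def vec_eq_iff mult.commute)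
  \<comment> \<open>x x^T alone is only semidefinite in general; the covariance with its positive
    factor supplies the strict sign.\<close>
  have S_pos: "0 < v \<bullet> (S *v v)" if "v \<noteq> 0" for v
  proof -
    have "0 < \<gamma>\<^sup>2 / (1 - \<gamma>\<^sup>2) * (v \<bullet> (\<Sigma> *v v))"
      using cov that \<gamma>2(3) unfolding sym_pos_def_def by (intro mult_pos_pos) auto
    then show ?thesis
      unfolding quad by (simp add: add_nonneg_pos)
  qed
  then have S_nonneg: "0 \<le> v \<bullet> (S *v v)" for v
    by (cases "v = 0") (auto intro: less_imp_le)
  have S: "sym_pos_def S"
    using S_sym S_pos by (simp add: sym_pos_def_def)
  have "sym_pos_semidef Z\<^sub>0" "invertible F \<longrightarrow> sym_pos_def Z\<^sub>0"
    using stein_solution_sym_pos_semidef[OF F \<gamma>2(1,2) S_sym S_nonneg]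
      stein_solution_sym_pos_def[OF F \<gamma>2(1,2) S_sym S_nonneg _ _ S] Z\<^sub>0 unfolding lyapunov_iff by auto
  moreover have "ext_variance M G =
         ereal (\<gamma>\<^sup>2 / (1 - \<gamma>\<^sup>2)) * ext_expectation M (\<lambda>\<omega>. (W \<omega> \<bullet> (P *v W \<omega>))\<^sup>2)
         - ereal (\<gamma>\<^sup>2 / (1 - \<gamma>\<^sup>2) * (trace (P ** \<Sigma>))\<^sup>2)
         + ereal (4 * \<gamma>\<^sup>2 * trace (P ** \<Sigma> ** P ** Z\<^sub>0))"
    unfolding G_def Z\<^sub>0_def \<Sigma>_def by (rule ext_variance_random_return_eq)
  moreover have "integrable M (\<lambda>\<omega>. (G \<omega>)\<^sup>2) \<and> variance G =
            \<gamma>\<^sup>2 / (1 - \<gamma>\<^sup>2) * expectation (\<lambda>\<omega>. (W \<omega> \<bullet> (P *v W \<omega>))\<^sup>2)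
            - \<gamma>\<^sup>2 / (1 - \<gamma>\<^sup>2) * (trace (P ** \<Sigma>))\<^sup>2
            + 4 * \<gamma>\<^sup>2 * trace (P ** \<Sigma> ** P ** Z\<^sub>0)"
    if "integrable M (\<lambda>\<omega>. (W \<omega> \<bullet> (P *v W \<omega>))\<^sup>2)"
    using has_bochner_integral_integral_eq[OF has_bochner_integral_variance[OF that, of x]]
      integrable_random_return_square[OF that]
    unfolding G_def Z\<^sub>0_def \<Sigma>_def by blast
  moreover have "integrable M G"
    unfolding G_def by (rule integrable_random_return)
  ultimately show ?thesis
    using Z\<^sub>0 unique by blast
qed

end
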